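(* Let $K$ be a field, let $E$ be an arbitrary directed graph, and let $I$ be a (two-sided) ideal of the Leavitt path algebra $L_K(E)$. Then $I^\perp$ is $\mathbb{Z}$-graded, i.e. $I^\perp=\bigoplus_{n\in\mathbb{Z}}\bigl(I^\perp\cap L_K(E)_n\bigr)$.
   Context: A graph $E=(E^0,E^1,r,s)$ consists of a countable set of vertices $E^0$, a countable set of edges $E^1$, and range and source maps $r,s:E^1\to E^0$. A nontrivial path is $\alpha=e_1\cdots e_n$ with $r(e_i)=s(e_{i+1})$ for $1\le i\le n-1$; its length is $|\alpha|=n$, $s(\alpha)=s(e_1)$, $r(\alpha)=r(e_n)$. Vertices are paths of length $0$ (with $s(v)=r(v)=v$). $E^*$ is the set of all finite paths. $E^0_{reg}$ is the set of vertices $v$ with $s^{-1}(v)$ nonempty and finite. The Leavitt path algebra $L_K(E)$ is the universal $K$-algebra generated by pairwise orthogonal idempotents $\{v:v\in E^0\}$ and elements $\{e,e^*:e\in E^1\}$ subject to: (1) $s(e)e=er(e)=e$ for all $e\in E^1$; (2) $r(e)e^*=e^*s(e)=e^*$ for all $e\in E^1$; (3) $e^*f=\delta_{e,f}\,r(e)$ for all $e,f\in E^1$; (4) $v=\sum_{e\in E^1,\,s(e)=v}ee^*$ for all $v\in E^0_{reg}$. For a path $\alpha=e_1\cdots e_n$, $\alpha^*=e_n^*\cdots e_1^*$, and $v^*=v$ for vertices. It is $\mathbb{Z}$-graded with homogeneous components $L_K(E)_n=\operatorname{span}_K\{\alpha\beta^*:\alpha,\beta\in E^*,\ |\alpha|-|\beta|=n\}$,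 $n\in\mathbb{Z}$. For a subset $X$ of an algebra $A$, $X^\perp=\{a\in A: ax=xa=0\text{ for all }x\in X\}$. *)

theory Defs
  imports
    "HOL-Algebra.QuotRing"
    "HOL-Algebra.Module"
    "HOL-Library.Countable_Set"
    "HOL-Library.Poly_Mapping"
    "Graph_Theory.Arc_Walk"
begin

section \<open>Graphs and paths\<close>

text \<open>
  A graph $(E^0, E^1, r, s)$ is a \<^const>\<open>wf_digraph\<close> with \<^const>\<open>verts\<close> $= E^0$,
  \<^const>\<open>arcs\<close> $= E^1$, \<^const>\<open>head\<close> $= r$ and \<^const>\<open>tail\<close> $= s$.  Loops and parallel edges
  are allowed.
\<close>

locale countable_digraph = wf_digraph +
  assumes countable_verts: "countable (verts G)"
    and countable_arcs: "countable (arcs G)"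

text \<open>
  A path is given by its source and its list of edges; the pair \<open>(v, [])\<close> is the vertex $v$,
  regarded as a path of length $0$.
\<close>

definition paths :: "('v, 'e) pre_digraph \<Rightarrow> ('v \<times> 'e list) set" where
  "paths E = {(u, p). \<exists>v. pre_digraph.awalk E u p v}"

definition path_length :: "'v \<times> 'e list \<Rightarrow> nat" where
  "path_length \<alpha> = length (snd \<alpha>)"

definition regular_verts :: "('v, 'e) pre_digraph \<Rightarrow> 'v set" where
  "regular_verts E = {v \<in> verts E. out_arcs E v \<noteq> {} \<and> finite (out_arcs E v)}"


section \<open>The free algebra\<close>

text \<open>
  The type \<open>'a \<Rightarrow>\<^sub>0 'k\<close> multiplies by convolution along the \<^emph>\<open>additive\<close> monoid
  structure of \<^typ>\<open>'a\<close>, so concatenation of words is written as addition, and the empty word is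
  \<open>0\<close>.  Thus \<open>'g free_word \<Rightarrow>\<^sub>0 'k\<close> is the free unital associative algebra on the type \<^typ>\<open>'g\<close>.
\<close>

datatype 'g free_word = Word (letters: "'g list")

instantiation free_word :: (type) monoid_add
begin

definition zero_free_word :: "'a free_word" where
  "zero_free_word = Word []"

definition plus_free_word :: "'a free_word \<Rightarrow> 'a free_word \<Rightarrow> 'a free_word" where
  "plus_free_word x y = Word (letters x @ letters y)"

instance
  by standard (simp_all add: zero_free_word_def plus_free_word_def)

end

datatype ('v, 'e) generator = Vertex 'v | Edge 'e | Ghost 'e

definition generators :: "('v, 'e) pre_digraph \<Rightarrow> ('v, 'e) generator set" where
  "generators E = Vertex ` verts E \<union> Edge ` arcs E \<union> Ghost ` arcs E"

type_synonym ('v, 'e, 'k) free_alg = "('v, 'e) generator free_word \<Rightarrow>\<^sub>0 'k"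

definition free_algebra :: "('v, 'e) pre_digraph \<Rightarrow> ('v, 'e, 'k :: field) free_alg ring" where
  "free_algebra E =
     \<lparr>carrier = {x. \<forall>w \<in> Poly_Mapping.keys x. set (letters w) \<subseteq> generators E},
      mult = (*), one = 1, zero = 0, add = (+)\<rparr>"

definition gen :: "'g \<Rightarrow> 'g free_word \<Rightarrow>\<^sub>0 'k :: field" where
  "gen g = Poly_Mapping.single (Word [g]) 1"

text \<open>Multiplication by the constant \<open>single 0 c\<close> is scalar multiplication by \<open>c\<close>.\<close>

definition scale :: "'k :: field \<Rightarrow> ('g free_word \<Rightarrow>\<^sub>0 'k) \<Rightarrow> ('g free_word \<Rightarrow>\<^sub>0 'k)" where
  "scale c x = Poly_Mapping.single 0 c * x"

abbreviation vertex_gen :: "'v \<Rightarrow> ('v, 'e, 'k :: field) free_alg" where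
  "vertex_gen v \<equiv> gen (Vertex v)"

abbreviation edge_gen :: "'e \<Rightarrow> ('v, 'e, 'k :: field) free_alg" where
  "edge_gen e \<equiv> gen (Edge e)"

abbreviation ghost_gen :: "'e \<Rightarrow> ('v, 'e, 'k :: field) free_alg" where
  "ghost_gen e \<equiv> gen (Ghost e)"

text \<open>A relation $x = y$ is recorded as the element $x - y$.\<close>

definition leavitt_relations ::
    "('v, 'e) pre_digraph \<Rightarrow> ('v, 'e, 'k :: field) free_alg set" where
  "leavitt_relations E =
     {vertex_gen v * vertex_gen w - (if v = w then vertex_gen v else 0)
        | v w. v \<in> verts E \<and> w \<in> verts E}
   \<union> {vertex_gen (tail E e) * edge_gen e - edge_gen e | e. e \<in> arcs E}
   \<union> {edge_gen e * vertex_gen (head E e) - edge_gen e | e. e \<in> arcs E}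
   \<union> {vertex_gen (head E e) * ghost_gen e - ghost_gen e | e. e \<in> arcs E}
   \<union> {ghost_gen e * vertex_gen (tail E e) - ghost_gen e | e. e \<in> arcs E}
   \<union> {ghost_gen e * edge_gen f - (if e = f then vertex_gen (head E e) else 0)
        | e f. e \<in> arcs E \<and> f \<in> arcs E}
   \<union> {vertex_gen v - (\<Sum>e \<in> out_arcs E v. edge_gen e * ghost_gen e) | v. v \<in> regular_verts E}"


section \<open>The Leavitt path algebra\<close>

text \<open>
  $L_K(E)$ need not be unital, so it is the free \<^emph>\<open>non-unital\<close> algebra (the elements
  of \<^const>\<open>free_algebra\<close> without constant term) modulo the relations.  All relations have zero
  constant term, hence the ideal they generate in \<^const>\<open>free_algebra\<close> lies in the free
  non-unital algebra and coincides with the ideal generated there: an ideal generated in a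
  non-unital algebra contains \<open>r\<close>, \<open>a r\<close>, \<open>r b\<close> and \<open>a r b\<close> for every generator \<open>r\<close>, and all
  scalar multiples of these.
\<close>

definition leavitt_ideal ::
    "('v, 'e) pre_digraph \<Rightarrow> ('v, 'e, 'k :: field) free_alg set" where
  "leavitt_ideal E = genideal (free_algebra E) (leavitt_relations E)"

type_synonym ('v, 'e, 'k) lpa = "('v, 'e, 'k) free_alg set"

definition lpa_class ::
    "('v, 'e) pre_digraph \<Rightarrow> ('v, 'e, 'k :: field) free_alg \<Rightarrow> ('v, 'e, 'k) lpa" where
  "lpa_class E x = a_r_coset (free_algebra E) (leavitt_ideal E) x"

text \<open>
  The operations are those of \<^const>\<open>FactRing\<close>.  The field \<open>one\<close> of the record is meaningless
  here, since $L_K(E)$ has a unit only if $E^0$ is finite.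
\<close>

definition leavitt_path_algebra ::
    "('v, 'e) pre_digraph \<Rightarrow> ('k :: field, ('v, 'e, 'k) lpa) module" where
  "leavitt_path_algebra E =
     \<lparr>carrier = lpa_class E ` {x \<in> carrier (free_algebra E). Poly_Mapping.lookup x 0 = 0},
      mult = rcoset_mult (free_algebra E) (leavitt_ideal E),
      one = undefined,
      zero = leavitt_ideal E,
      add = set_add (free_algebra E),
      smult = (\<lambda>c X. \<Union>x \<in> X. lpa_class E (scale c x))\<rparr>"

definition lpa_path ::
    "('v, 'e) pre_digraph \<Rightarrow> 'v \<times> 'e list \<Rightarrow> ('v, 'e, 'k :: field) lpa" where
  "lpa_path E \<alpha> = lpa_class E
     (case \<alpha> of (v, []) \<Rightarrow> vertex_gen v | (v, e # p) \<Rightarrow> prod_list (map edge_gen (e # p)))"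

definition lpa_ghost_path ::
    "('v, 'e) pre_digraph \<Rightarrow> 'v \<times> 'e list \<Rightarrow> ('v, 'e, 'k :: field) lpa" where
  "lpa_ghost_path E \<alpha> = lpa_class E
     (case \<alpha> of (v, []) \<Rightarrow> vertex_gen v | (v, e # p) \<Rightarrow> prod_list (map ghost_gen (rev (e # p))))"

inductive_set lin_span :: "('k, 'a, 'm) module_scheme \<Rightarrow> 'a set \<Rightarrow> 'a set"
  for M :: "('k, 'a, 'm) module_scheme" (structure) and S :: "'a set" where
  zero: "\<zero> \<in> lin_span M S"
| add_smult: "x \<in> S \<Longrightarrow> y \<in> lin_span M S \<Longrightarrow> (c \<odot> x) \<oplus> y \<in> lin_span M S"

definition lpa_component ::
    "('v, 'e) pre_digraph \<Rightarrow> int \<Rightarrow> ('v, 'e, 'k :: field) lpa set" where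
  "lpa_component E n = lin_span (leavitt_path_algebra E)
     {lpa_path E \<alpha> \<otimes>\<^bsub>leavitt_path_algebra E :: ('k, ('v, 'e, 'k) lpa) module\<^esub> lpa_ghost_path E \<beta>
        | \<alpha> \<beta>. \<alpha> \<in> paths E \<and> \<beta> \<in> paths E \<and> int (path_length \<alpha>) - int (path_length \<beta>) = n}"


section \<open>Ideals, annihilators and direct sums\<close>

text \<open>
  The locale \<^locale>\<open>ideal\<close> presupposes a unital ring.
\<close>

definition two_sided_ideal :: "('a, 'm) ring_scheme \<Rightarrow> 'a set \<Rightarrow> bool" where
  "two_sided_ideal A I \<longleftrightarrow> additive_subgroup I A \<and>
     (\<forall>x \<in> I. \<forall>a \<in> carrier A. a \<otimes>\<^bsub>A\<^esub> x \<in> I \<and> x \<otimes>\<^bsub>A\<^esub> a \<in> I)"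

definition perp :: "('a, 'm) ring_scheme \<Rightarrow> 'a set \<Rightarrow> 'a set" where
  "perp A X = {a \<in> carrier A. \<forall>x \<in> X. a \<otimes>\<^bsub>A\<^esub> x = \<zero>\<^bsub>A\<^esub> \<and> x \<otimes>\<^bsub>A\<^esub> a = \<zero>\<^bsub>A\<^esub>}"

text \<open>
  $H$ is the internal direct sum of the $N_i$: summation maps the finitely supported families
  $(x_i)$ with $x_i \in N_i$ bijectively onto $H$.
\<close>

definition is_internal_direct_sum ::
    "('a, 'm) ring_scheme \<Rightarrow> 'a set \<Rightarrow> ('i \<Rightarrow> 'a set) \<Rightarrow> bool" where
  "is_internal_direct_sum A H N \<longleftrightarrow>
     bij_betw (\<lambda>x. finsum A x {i. x i \<noteq> \<zero>\<^bsub>A\<^esub>})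
       {x. (\<forall>i. x i \<in> N i) \<and> finite {i. x i \<noteq> \<zero>\<^bsub>A\<^esub>}} H"

end

theory Submission
  imports Defs
begin

text \<open>
  Let $a \in I^\perp$, so that $a L b = 0$ for all $b \in I$.  If $a_N$ is the component of $a$ of top
  degree, a comparison of degrees shows $a_N L b_j = 0$ for every component of $b$ as soon as $L$ is
  graded semiprime, i.e. $x L x = 0$ forces $x = 0$ for homogeneous $x$; splitting off $a_N$ and
  repeating, all components of $a$ lie in $I^\perp$.

  Graded semiprimeness: write a homogeneous $x$ as a sum of a combination of paths and of terms
  $y e^*$.  If $x L x = 0$, the same holds for $x e$, in which the ghost parts are shorter, so
  $x e = 0$ for all edges $e$.  At a regular vertex $w$ this gives $x w = \sum_e x e e^* = 0$.
  At an infinite emitter one multiplies by an edge that does not occur in $x$ to see that the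
  ghost-free part vanishes.  Both this cancellation and the ghost-free case need that vertices
  are nonzero in $L$, which is shown by a representation on functions on $E^0 \times \mathbb{N}$.
\<close>


section \<open>Annihilators in graded rings\<close>

text \<open>The monomials alpha beta* span L, but relation (4) makes them linearly dependent as soon
  as there is a regular vertex, so coefficients of an element cannot be read off. The proof cuts
  elements by vertices and multiplies them by edges and ghost edges instead, since these operations
  respect congruence modulo an ideal \<open>J\<close> of the free algebra. Working in the free
  algebra also supplies a unit, which L may lack; the price is that constant terms have to be
  excluded where elements of L are meant.

  The factor N in the representation is forced by relation (4): the space at a regular vertex has to
  be the direct sum of the spaces at the ranges of its edges. At a vertex that emits exactly two
  edges, both loops, this space is isomorphic to its own double, so finite-dimensional spaces do not
  suffice. A countably infinite index set at every vertex meets all these conditions at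
  once.\<close>

locale type_ideal =
  fixes J :: "'a :: ring_1 set"
  assumes zero_mem [simp]: "0 \<in> J"
    and add_mem: "x \<in> J \<Longrightarrow> y \<in> J \<Longrightarrow> x + y \<in> J"
    and lmult_mem: "x \<in> J \<Longrightarrow> r * x \<in> J"
    and rmult_mem: "x \<in> J \<Longrightarrow> x * r \<in> J"
begin

lemma uminus_mem: "x \<in> J \<Longrightarrow> - x \<in> J"
  using lmult_mem[of x "- 1"] by simp

lemma diff_mem: "x \<in> J \<Longrightarrow> y \<in> J \<Longrightarrow> x - y \<in> J"
  using add_mem[of x "- y"] uminus_mem by simp

lemma sum_mem: "(\<And>i. i \<in> S \<Longrightarrow> f i \<in> J) \<Longrightarrow> sum f S \<in> J"
  by (induction S rule: infinite_finite_induct) (auto intro: add_mem)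

end

locale graded_ring_ideal = type_ideal J for J :: "'a :: ring_1 set" +
  fixes comp :: "int \<Rightarrow> 'a \<Rightarrow> 'a" and A :: "'a set"
  assumes comp_add: "comp n (x + y) = comp n x + comp n y"
    and finite_comp: "finite {n. comp n x \<noteq> 0}"
    and sum_comp: "(\<Sum>n | comp n x \<noteq> 0. comp n x) = x"
    and comp_comp: "comp m (comp n x) = (if m = n then comp n x else 0)"
    and comp_mult: "finite D \<Longrightarrow> (\<And>i. comp i x \<noteq> 0 \<Longrightarrow> i \<in> D) \<Longrightarrow>
          comp n (x * y) = (\<Sum>i\<in>D. comp i x * comp (n - i) y)"
    and comp_mem: "x \<in> J \<Longrightarrow> comp n x \<in> J"
    and A_lmult: "x \<in> A \<Longrightarrow> r * x \<in> A"
    and A_rmult: "x \<in> A \<Longrightarrow> x * r \<in> A"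
    and A_diff: "x \<in> A \<Longrightarrow> y \<in> A \<Longrightarrow> x - y \<in> A"
    and A_comp: "x \<in> A \<Longrightarrow> comp n x \<in> A"
    and semiprime: \<comment> \<open>only on \<open>A\<close>: in the application the ambient ring has an adjoined unit\<close>
      "x \<in> A \<Longrightarrow> comp n x = x \<Longrightarrow> (\<And>r. x * r * x \<in> J) \<Longrightarrow> x \<in> J"
begin

lemma comp_zero [simp]: "comp n 0 = 0"
  using comp_add[of n 0 0] by simp

lemma comp_diff: "comp n (x - y) = comp n x - comp n y"
  using comp_add[of n "x - y" y] by (simp add: algebra_simps)

lemma homogeneous_eq_0: "comp m x = x \<Longrightarrow> n \<noteq> m \<Longrightarrow> comp n x = 0"
  using comp_comp[of n m x] by simp

lemma comp_mult_left_homogeneous: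
  assumes "comp m x = x"
  shows "comp n (x * y) = x * comp (n - m) y"
proof -
  have "i \<in> {m}" if "comp i x \<noteq> 0" for i
    using that homogeneous_eq_0[OF assms] by auto
  then show ?thesis
    using comp_mult[of "{m}" x n y] assms by simp
qed

lemma comp_mult_homogeneous:
  "comp m x = x \<Longrightarrow> comp n y = y \<Longrightarrow> comp (m + n) (x * y) = x * y"
  by (simp add: comp_mult_left_homogeneous)

text \<open>For homogeneous x, r and y the product x r y is homogeneous, which
  \<open>semiprime\<close> demands; this reduces a general r to that case.\<close>

lemma triple_mult_mem_homogeneous:
  assumes "\<And>d r. comp d r = r \<Longrightarrow> x * r * y \<in> J"
  shows "x * r * y \<in> J"
proof -
  have "x * r * y = (\<Sum>n | comp n r \<noteq> 0. x * comp n r * y)"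
    by (subst (1) sum_comp[of r, symmetric]) (simp add: sum_distrib_left sum_distrib_right)
  also have "\<dots> \<in> J"
    using comp_comp by (intro sum_mem assms) auto
  finally show ?thesis .
qed

text \<open>In a semiprime ring $x R y = 0$ implies $y R x = 0$, because $(yrx) R (yrx) = 0$.\<close>

lemma annihilator_flip:
  assumes A: "x \<in> A" "y \<in> A" and h: "comp m x = x" "comp n y = y"
    and 0: "\<And>r. x * r * y \<in> J"
  shows "y * r * x \<in> J"
proof (rule triple_mult_mem_homogeneous)
  fix d r assume r: "comp d r = r"
  show "y * r * x \<in> J"
  proof (rule semiprime)
    show "comp (n + d + m) (y * r * x) = y * r * x"
      using h r by (intro comp_mult_homogeneous) auto
    fix s
    have "y * r * (x * s * y) * (r * x) \<in> J"
      by (rule rmult_mem[OF lmult_mem[OF 0]])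
    then show "y * r * x * s * (y * r * x) \<in> J" by (simp add: mult.assoc)
  qed (use A in \<open>auto intro: A_lmult\<close>)
qed

lemma annihilates_components_right:
  assumes "\<And>j. x * r * comp j y \<in> J"
  shows "x * r * y \<in> J"
proof -
  have "x * r * y = (\<Sum>n | comp n y \<noteq> 0. x * r * comp n y)"
    by (subst (1) sum_comp[of y, symmetric]) (simp add: sum_distrib_left)
  also have "\<dots> \<in> J" using assms by (intro sum_mem) auto
  finally show ?thesis .
qed

text \<open>
  Downward induction on \<open>j\<close>.  The component of degree $N + d + j$ of $a r b$ is
  $\sum_i a_i r b_{N+j-i}$; multiplied on the right by $s a_N r b_j$ only $i = N$ survives, as
  $b_{j'} s a_N = 0$ for $j' > j$ by flipping the induction hypothesis.
\<close>

lemma leading_component_annihilates: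
  assumes A: "a \<in> A" "b \<in> A"
    and 0: "\<And>r. a * r * b \<in> J"
    and N: "\<And>i. i > N \<Longrightarrow> comp i a = 0"
  shows "comp N a * r * comp j b \<in> J"
proof -
  \<comment> \<open>All components of b above degree M vanish, so the induction hypothesis is only
    needed for degrees up to M, and there nat (M - j) decreases.\<close>
  obtain M where M: "comp j b \<noteq> 0 \<Longrightarrow> j \<le> M" for j
    using finite_comp[of b] by (metis (mono_tags, lifting) Max_ge mem_Collect_eq)
  show ?thesis
  proof (induction "nat (M - j)" arbitrary: j r rule: less_induct)
    case less
    have higher: "comp N a * r * comp j' b \<in> J" if "j' > j" for j' r
    proof (cases "comp j' b = 0")
      case False
      then have "nat (M - j') < nat (M - j)" using M[of j'] that by auto
      then show ?thesis by (rule less)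
    qed simp
    show ?case
    proof (rule triple_mult_mem_homogeneous)
      fix d r assume r: "comp d r = r"
      define D where "D = {i. comp i a \<noteq> 0}"
      define q where "q = comp N a * r * comp j b"
      have D: "finite D" using finite_comp by (simp add: D_def)
      \<comment> \<open>The component of a in degree N may vanish, hence \<open>insert N D\<close>:
        its term has to be split off in either case.\<close>
      have "comp (N + d + j) (a * (r * b)) = (\<Sum>i\<in>insert N D. comp i a * comp (N + d + j - i) (r * b))"
        using D by (intro comp_mult) (auto simp: D_def)
      also have "\<dots> = (\<Sum>i\<in>insert N D. comp i a * (r * comp (N + j - i) b))"
        by (intro sum.cong) (auto simp: comp_mult_left_homogeneous[OF r] algebra_simps)
      also have "\<dots> = q + (\<Sum>i\<in>D - {N}. comp i a * r * comp (N + j - i) b)"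
        using D by (subst sum.insert_remove) (auto simp: q_def mult.assoc)
      finally have *: "q + (\<Sum>i\<in>D - {N}. comp i a * r * comp (N + j - i) b) \<in> J"
        using comp_mem[OF 0[of r], of "N + d + j"] by (simp add: mult.assoc)
      have "q \<in> J"
      proof (rule semiprime)
        show "comp (N + d + j) q = q"
          using r comp_comp unfolding q_def by (intro comp_mult_homogeneous) auto
        show "q \<in> A" unfolding q_def using A by (auto intro: A_lmult A_comp)
        fix s
        have "(\<Sum>i\<in>D - {N}. comp i a * r * comp (N + j - i) b) * s * q \<in> J"
          unfolding sum_distrib_right
        proof (rule sum_mem)
          fix i assume i: "i \<in> D - {N}"
          then have "i \<le> N" using N[of i] by (auto simp: D_def not_less[symmetric])
          then have "N + j - i > j" using i by auto
          then have "comp (N + j - i) b * s * comp N a \<in> J"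
            by (intro annihilator_flip[of "comp N a" _ N "N + j - i"] higher)
              (auto simp: comp_comp intro: A_comp A)
          then have "comp i a * r * (comp (N + j - i) b * s * comp N a) * (r * comp j b) \<in> J"
            by (rule rmult_mem[OF lmult_mem])
          then show "comp i a * r * comp (N + j - i) b * s * q \<in> J"
            by (simp add: q_def mult.assoc)
        qed
        moreover have "(q + (\<Sum>i\<in>D - {N}. comp i a * r * comp (N + j - i) b)) * s * q \<in> J"
          using * by (intro rmult_mem)
        ultimately show "q * s * q \<in> J"
          using diff_mem by (simp add: distrib_right) (metis add_diff_cancel_right')
      qed
      then show "comp N a * r * comp j b \<in> J" by (simp add: q_def)
    qed
  qed
qed

theorem components_annihilate:
  assumes "a \<in> A" "b \<in> A" and "\<And>r. a * r * b \<in> J"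
  shows "comp i a * r * comp j b \<in> J"
  using assms(1,3)
proof (induction "card {i. comp i a \<noteq> 0}" arbitrary: a i r j rule: less_induct)
  case (less a)
  show ?case
  proof (cases "{i. comp i a \<noteq> 0} = {}")
    case True
    then have "comp i a = 0" by blast
    then show ?thesis by simp
  next
    case False
    define D where "D = {i. comp i a \<noteq> 0}"
    define N where "N = Max D"
    have D: "finite D" "D \<noteq> {}" using finite_comp False by (auto simp: D_def)
    have "N \<in> D" unfolding N_def by (rule Max_in[OF D])
    then have N: "comp N a \<noteq> 0" by (simp add: D_def)
    have N_max: "comp i a = 0" if "i > N" for i
    proof -
      have "i \<notin> D"
        using Max_ge[OF D(1)] that unfolding N_def by force
      then show ?thesis by (simp add: D_def)
    qed
    have top: "comp N a * r * comp j b \<in> J" for r j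
      using less.prems assms(2) N_max by (intro leading_component_annihilates)
    define a' where "a' = a - comp N a"
    have comp_a': "comp i a' = (if i = N then 0 else comp i a)" for i
      by (simp add: a'_def comp_diff comp_comp)
    have "{i. comp i a' \<noteq> 0} \<subset> {i. comp i a \<noteq> 0}"
      using N by (auto simp: comp_a')
    then have "card {i. comp i a' \<noteq> 0} < card {i. comp i a \<noteq> 0}"
      using finite_comp by (intro psubset_card_mono)
    moreover have "a' \<in> A" using less.prems A_comp A_diff by (simp add: a'_def)
    \<comment> \<open>By \<open>top\<close>, a_N r is orthogonal to each component of b, hence to b
      itself, so subtracting a_N keeps the hypothesis.\<close>
    moreover have "a' * r * b \<in> J" for r
      using diff_mem[OF less.prems(2)[of r] annihilates_components_right[OF top]]
      by (simp add: a'_def algebra_simps)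
    ultimately have IH: "comp i a' * r * comp j b \<in> J" by (rule less.hyps)
    show ?thesis using IH top by (cases "i = N") (auto simp: comp_a')
  qed
qed

text \<open>The unit of the ambient ring turns a_i r b into a_i b. The product in the other order
  comes from \<open>annihilator_flip\<close>, applied to the homogeneous pairs a_i and b_j.\<close>

corollary component_annihilates:
  assumes A: "a \<in> A" "b \<in> A" and 0: "\<And>r. a * r * b \<in> J"
  shows "comp i a * b \<in> J" and "b * comp i a \<in> J"
proof -
  have *: "comp i a * r * comp j b \<in> J" for r j
    using assms by (rule components_annihilate)
  show "comp i a * b \<in> J"
    using annihilates_components_right[OF *, where r = 1] by simp
  have "comp j b * 1 * comp i a \<in> J" for j
    using A_comp A comp_comp by (intro annihilator_flip[OF _ _ _ _ *]) auto
  then have "(\<Sum>j | comp j b \<noteq> 0. comp j b * comp i a) \<in> J"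
    by (intro sum_mem) simp
  then show "b * comp i a \<in> J"
    by (subst sum_comp[of b, symmetric]) (simp add: sum_distrib_right)
qed

end

section \<open>Calculating modulo an ideal\<close>

context type_ideal
begin

definition eqv :: "'a \<Rightarrow> 'a \<Rightarrow> bool" (infix \<open>\<approx>\<close> 50) where
  "x \<approx> y \<longleftrightarrow> x - y \<in> J"

lemma eqv_refl [simp, intro]: "x \<approx> x"
  by (simp add: eqv_def)

lemma eqv_sym: "x \<approx> y \<Longrightarrow> y \<approx> x"
  using uminus_mem[of "x - y"] by (simp add: eqv_def)

lemma eqv_trans [trans]: "x \<approx> y \<Longrightarrow> y \<approx> z \<Longrightarrow> x \<approx> z"
  using add_mem[of "x - y" "y - z"] by (simp add: eqv_def)

lemma eqv_0 [simp]: "x \<approx> 0 \<longleftrightarrow> x \<in> J"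
  by (simp add: eqv_def)

lemma eqv_mem: "x \<approx> y \<Longrightarrow> y \<in> J \<Longrightarrow> x \<in> J"
  using eqv_trans[of x y 0] by simp

lemma eqv_mem': "x \<approx> y \<Longrightarrow> x \<in> J \<Longrightarrow> y \<in> J"
  using eqv_mem eqv_sym by blast

lemma eqv_add: "x \<approx> x' \<Longrightarrow> y \<approx> y' \<Longrightarrow> x + y \<approx> x' + y'"
  using add_mem[of "x - x'" "y - y'"] by (simp add: eqv_def algebra_simps)

lemma eqv_lmult: "x \<approx> y \<Longrightarrow> r * x \<approx> r * y"
  using lmult_mem[of "x - y" r] by (simp add: eqv_def algebra_simps)

lemma eqv_rmult: "x \<approx> y \<Longrightarrow> x * r \<approx> y * r"
  using rmult_mem[of "x - y" r] by (simp add: eqv_def algebra_simps)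

lemma eqv_mult: "x \<approx> x' \<Longrightarrow> y \<approx> y' \<Longrightarrow> x * y \<approx> x' * y'"
  using eqv_trans[OF eqv_rmult eqv_lmult] .

lemma eqv_sum: "(\<And>i. i \<in> S \<Longrightarrow> f i \<approx> g i) \<Longrightarrow> sum f S \<approx> sum g S"
  using sum_mem[of S "\<lambda>i. f i - g i"] by (simp add: eqv_def sum_subtractf)

text \<open>Sums suffice, because in all uses the coefficients already sit inside the generators.
  Including \<open>J\<close> makes membership depend only on the class modulo
  \<open>J\<close>.\<close>

inductive_set additive_span :: "'a set \<Rightarrow> 'a set" for S where
  base: "x \<in> J \<Longrightarrow> x \<in> additive_span S"
| step: "x \<in> S \<Longrightarrow> y \<in> additive_span S \<Longrightarrow> x + y \<in> additive_span S"

lemma additive_span_incl: "x \<in> S \<Longrightarrow> x \<in> additive_span S"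
  using additive_span.step[of x S 0] additive_span.base[of 0 S] by simp

lemma additive_span_add:
  assumes "x \<in> additive_span S" "y \<in> additive_span S"
  shows "x + y \<in> additive_span S"
  using assms(1)
proof induction
  case (base x)
  from assms(2) show ?case
  proof induction
    case (base y)
    then show ?case using add_mem \<open>x \<in> J\<close> additive_span.base by blast
  next
    case (step s y)
    then show ?case using additive_span.step[of s S "x + y"] by (simp add: add.left_commute)
  qed
next
  case (step s x)
  then show ?case using additive_span.step[of s S "x + y"] by (simp add: add.assoc)
qed

lemma additive_span_eqv:
  assumes "x \<approx> y" "y \<in> additive_span S"
  shows "x \<in> additive_span S"
  using additive_span_add[OF additive_span.base[of "x - y"] assms(2)] assms(1)
  by (simp add: eqv_def)

lemma additive_span_map:
  assumes "x \<in> additive_span S"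
    and "\<And>x y. \<phi> (x + y) = \<phi> x + \<phi> y" "\<And>x. x \<in> J \<Longrightarrow> \<phi> x \<in> J"
    and "\<And>x. x \<in> S \<Longrightarrow> \<phi> x \<in> additive_span T"
  shows "\<phi> x \<in> additive_span T"
  using assms(1) by induction (auto simp: assms(2) intro: assms additive_span.base additive_span_add)

lemma additive_span_mono:
  assumes "\<And>x. x \<in> S \<Longrightarrow> x \<in> additive_span T"
  shows "additive_span S \<subseteq> additive_span T"
  using additive_span_map[of _ S "\<lambda>x. x" T] assms by auto

lemma additive_span_lmult:
  "x \<in> additive_span S \<Longrightarrow> (\<And>x. x \<in> S \<Longrightarrow> r * x \<in> additive_span T) \<Longrightarrow> r * x \<in> additive_span T"
  by (rule additive_span_map[where \<phi> = "\<lambda>x. r * x"]) (simp_all add: distrib_left lmult_mem)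

lemma additive_span_rmult:
  "x \<in> additive_span S \<Longrightarrow> (\<And>x. x \<in> S \<Longrightarrow> x * r \<in> additive_span T) \<Longrightarrow> x * r \<in> additive_span T"
  by (rule additive_span_map[where \<phi> = "\<lambda>x. x * r"]) (simp_all add: distrib_right rmult_mem)

text \<open>
  The quantification over all larger \<open>B\<close> makes the property stable under addition.
\<close>

definition decomposes :: "'i set \<Rightarrow> ('i \<Rightarrow> 'a \<Rightarrow> 'a) \<Rightarrow> 'a \<Rightarrow> bool" where
  "decomposes I \<phi> x \<longleftrightarrow>
     (\<exists>W. finite W \<and> W \<subseteq> I \<and> (\<forall>B. finite B \<and> W \<subseteq> B \<and> B \<subseteq> I \<longrightarrow> x \<approx> (\<Sum>i\<in>B. \<phi> i x)))"

lemma decomposes_single: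
  assumes k: "k \<in> I" and \<phi>: "\<And>i. i \<in> I \<Longrightarrow> \<phi> i x \<approx> (if i = k then x else 0)"
  shows "decomposes I \<phi> x"
  unfolding decomposes_def
proof (intro exI[of _ "{k}"] conjI allI impI)
  fix B assume B: "finite B \<and> {k} \<subseteq> B \<and> B \<subseteq> I"
  have "(\<Sum>i\<in>B. \<phi> i x) \<approx> (\<Sum>i\<in>B. if i = k then x else 0)"
    using B \<phi> by (intro eqv_sum) blast
  also have "\<dots> = x" using B by simp
  finally show "x \<approx> (\<Sum>i\<in>B. \<phi> i x)" by (rule eqv_sym)
qed (use k in auto)

lemma decomposes_additive_span:
  assumes "x \<in> additive_span S"
    and add: "\<And>i x y. \<phi> i (x + y) = \<phi> i x + \<phi> i y" and J: "\<And>i x. x \<in> J \<Longrightarrow> \<phi> i x \<in> J"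
    and S: "\<And>x. x \<in> S \<Longrightarrow> decomposes I \<phi> x"
  shows "decomposes I \<phi> x"
  using assms(1)
proof induction
  case (base x)
  have "x \<approx> (\<Sum>i\<in>B. \<phi> i x)" for B
    using base J by (simp add: eqv_def diff_mem sum_mem)
  then show ?case unfolding decomposes_def by (intro exI[of _ "{}"]) simp
next
  case (step x y)
  obtain W where W: "finite W" "W \<subseteq> I"
    "\<forall>B. finite B \<and> W \<subseteq> B \<and> B \<subseteq> I \<longrightarrow> x \<approx> (\<Sum>i\<in>B. \<phi> i x)"
    using S[OF step(1)] unfolding decomposes_def by (elim exE conjE)
  obtain W' where W': "finite W'" "W' \<subseteq> I"
    "\<forall>B. finite B \<and> W' \<subseteq> B \<and> B \<subseteq> I \<longrightarrow> y \<approx> (\<Sum>i\<in>B. \<phi> i y)"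
    using step(3) unfolding decomposes_def by (elim exE conjE)
  show ?case unfolding decomposes_def
  proof (intro exI[of _ "W \<union> W'"] conjI allI impI)
    fix B assume B: "finite B \<and> W \<union> W' \<subseteq> B \<and> B \<subseteq> I"
    then have "x + y \<approx> (\<Sum>i\<in>B. \<phi> i x) + (\<Sum>i\<in>B. \<phi> i y)"
      by (intro eqv_add W(3)[rule_format] W'(3)[rule_format]) auto
    then show "x + y \<approx> (\<Sum>i\<in>B. \<phi> i (x + y))"
      by (simp add: add sum.distrib)
  qed (use W W' in auto)
qed

lemma decomposes_eqv_sum:
  assumes "decomposes I \<phi> x"
  obtains W where "finite W" "W \<subseteq> I" "x \<approx> (\<Sum>i\<in>W. \<phi> i x)"
  using assms unfolding decomposes_def by (elim exE conjE) (metis order_refl)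

text \<open>This makes membership in \<open>J\<close> a local question: it is checked one vertex or
  one edge at a time, without assuming that the whole index set is finite.\<close>

lemma decomposes_mem:
  assumes "decomposes I \<phi> x" "\<And>i. i \<in> I \<Longrightarrow> \<phi> i x \<in> J"
  shows "x \<in> J"
proof -
  obtain W where "finite W" "W \<subseteq> I" "x \<approx> (\<Sum>i\<in>W. \<phi> i x)"
    using decomposes_eqv_sum assms(1) .
  then show ?thesis using assms(2) by (meson eqv_mem sum_mem subsetD)
qed

text \<open>A witness against semiprimeness, if it lies outside \<open>J\<close>. The property
  passes to left and right multiples and to congruent elements, but not to sums in general, so every
  reduction to a simpler element has to be a multiplication.\<close>

definition null :: "'a \<Rightarrow> bool" where
  "null x \<longleftrightarrow> (\<forall>r. x * r * x \<in> J)"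

lemma null_lmult: "null x \<Longrightarrow> null (s * x)"
  unfolding null_def using lmult_mem[of "x * _ * x" s] by (metis mult.assoc)

lemma null_rmult: "null x \<Longrightarrow> null (x * s)"
  unfolding null_def using rmult_mem[of "x * _ * x" s] by (metis mult.assoc)

lemma null_eqv: "x \<approx> y \<Longrightarrow> null x \<Longrightarrow> null y"
  unfolding null_def by (meson eqv_mem' eqv_mult eqv_rmult)

end

lemma poly_mapping_single_induct [case_names zero single]:
  assumes "P 0" "\<And>k c f. P f \<Longrightarrow> P (Poly_Mapping.single k c + f)"
  shows "P (f :: 'a \<Rightarrow>\<^sub>0 'b :: comm_monoid_add)"
proof (induction f rule: update_induct)
  case const
  then show ?case by fact
next
  case (update f a b)
  have "Poly_Mapping.update a b f = Poly_Mapping.single a b + f"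
    using update(1) by (intro poly_mapping_eqI)
      (auto simp: lookup_update lookup_add lookup_single when_def in_keys_iff)
  then show ?case using assms(2) update by simp
qed

abbreviation scalar :: "'k \<Rightarrow> 'g free_word \<Rightarrow>\<^sub>0 'k :: field" where
  "scalar c \<equiv> Poly_Mapping.single 0 c"

lemma scalar_commute: "x * scalar c = scalar c * (x :: 'g free_word \<Rightarrow>\<^sub>0 'k :: field)"
  by (induction x rule: poly_mapping_single_induct)
    (simp_all add: distrib_left distrib_right mult_single mult.commute)

lemma scalar_left_commute: "x * (scalar c * y) = scalar c * (x * (y :: 'g free_word \<Rightarrow>\<^sub>0 'k :: field))"
  by (metis scalar_commute mult.assoc)

lemma scalar_mult_scalar: "scalar c * (scalar d * x) = scalar (c * d) * (x :: 'g free_word \<Rightarrow>\<^sub>0 'k :: field)"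
  by (simp add: mult.assoc[symmetric] mult_single)

section \<open>Graded semiprimeness of the Leavitt path algebra\<close>

text \<open>
  \<open>J\<close> is an ideal of the free algebra on all letters of the type; the letters outside the graph are
  killed by assumption \<open>outside\<close>, so no carrier conditions are needed.
\<close>

locale leavitt_quotient = wf_digraph G + type_ideal J
  for G :: "('v, 'e) pre_digraph" and J :: "('v, 'e, 'k :: field) free_alg set" +
  assumes relations: "leavitt_relations G \<subseteq> J"
    and outside: "g \<notin> generators G \<Longrightarrow> gen g \<in> J"
    and vertex_nonzero: "v \<in> verts G \<Longrightarrow> vertex_gen v \<notin> J"
begin

section \<open>The defining relations as congruences\<close>

abbreviation "V \<equiv> vertex_gen :: _ \<Rightarrow> ('v, 'e, 'k) free_alg"
abbreviation "X \<equiv> edge_gen :: _ \<Rightarrow> ('v, 'e, 'k) free_alg"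
abbreviation "Y \<equiv> ghost_gen :: _ \<Rightarrow> ('v, 'e, 'k) free_alg"

lemma V_V: "v \<in> verts G \<Longrightarrow> w \<in> verts G \<Longrightarrow> V v * V w \<approx> (if v = w then V v else 0)"
  unfolding eqv_def by (rule subsetD[OF relations]) (unfold leavitt_relations_def, blast)

lemma tail_X: "e \<in> arcs G \<Longrightarrow> V (tail G e) * X e \<approx> X e"
  unfolding eqv_def by (rule subsetD[OF relations]) (unfold leavitt_relations_def, blast)

lemma X_head: "e \<in> arcs G \<Longrightarrow> X e * V (head G e) \<approx> X e"
  unfolding eqv_def by (rule subsetD[OF relations]) (unfold leavitt_relations_def, blast)

lemma head_Y: "e \<in> arcs G \<Longrightarrow> V (head G e) * Y e \<approx> Y e"
  unfolding eqv_def by (rule subsetD[OF relations]) (unfold leavitt_relations_def, blast)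

lemma Y_tail: "e \<in> arcs G \<Longrightarrow> Y e * V (tail G e) \<approx> Y e"
  unfolding eqv_def by (rule subsetD[OF relations]) (unfold leavitt_relations_def, blast)

lemma Y_X: "e \<in> arcs G \<Longrightarrow> f \<in> arcs G \<Longrightarrow> Y e * X f \<approx> (if e = f then V (head G e) else 0)"
  unfolding eqv_def by (rule subsetD[OF relations]) (unfold leavitt_relations_def, blast)

lemma V_regular: "v \<in> regular_verts G \<Longrightarrow> V v \<approx> (\<Sum>e\<in>out_arcs G v. X e * Y e)"
  unfolding eqv_def by (rule subsetD[OF relations]) (unfold leavitt_relations_def, blast)

text \<open>From x = u x follows v x = (v u) x, and orthogonality decides. A single known unit
  vertex thus determines the action of all vertices.\<close>

lemma V_mult_left_unit:
  assumes "V u * x \<approx> x" "u \<in> verts G" "v \<in> verts G"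
  shows "V v * x \<approx> (if v = u then x else 0)"
proof -
  have "V v * x \<approx> V v * (V u * x)" by (rule eqv_lmult[OF eqv_sym[OF assms(1)]])
  also have "\<dots> = V v * V u * x" by (simp add: mult.assoc)
  also have "\<dots> \<approx> (if v = u then V v else 0) * x" using assms by (intro eqv_rmult V_V)
  also have "\<dots> \<approx> (if v = u then x else 0)" using assms(1) by simp
  finally show ?thesis .
qed

lemma V_mult_right_unit:
  assumes "x * V u \<approx> x" "u \<in> verts G" "v \<in> verts G"
  shows "x * V v \<approx> (if v = u then x else 0)"
proof -
  have "x * V v \<approx> x * V u * V v" by (rule eqv_rmult[OF eqv_sym[OF assms(1)]])
  also have "\<dots> = x * (V u * V v)" by (simp add: mult.assoc)
  also have "\<dots> \<approx> x * (if u = v then V u else 0)" using assms by (intro eqv_lmult V_V)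
  also have "\<dots> \<approx> (if v = u then x else 0)" using assms(1) by simp
  finally show ?thesis .
qed

lemmas V_X = V_mult_left_unit[OF tail_X tail_in_verts]
lemmas V_Y = V_mult_left_unit[OF head_Y head_in_verts]
lemmas X_V = V_mult_right_unit[OF X_head head_in_verts]
lemmas Y_V = V_mult_right_unit[OF Y_tail tail_in_verts]

lemma scalar_V_mem_iff:
  assumes "v \<in> verts G" shows "scalar c * V v \<in> J \<longleftrightarrow> c = 0"
proof
  assume "scalar c * V v \<in> J"
  then have "scalar (inverse c) * (scalar c * V v) \<in> J" by (rule lmult_mem)
  then have "scalar (inverse c * c) * V v \<in> J" by (simp only: scalar_mult_scalar)
  then show "c = 0" using vertex_nonzero[OF assms] by (cases "c = 0") auto
qed simp

end

fun letter_degree :: "('v, 'e) generator \<Rightarrow> int" where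
  "letter_degree (Vertex v) = 0"
| "letter_degree (Edge e) = 1"
| "letter_degree (Ghost e) = - 1"

definition word_degree :: "('v, 'e) generator free_word \<Rightarrow> int" where
  "word_degree w = (\<Sum>g\<leftarrow>letters w. letter_degree g)"

section \<open>Ghost-free elements\<close>

context leavitt_quotient
begin

primrec edge_span :: "nat \<Rightarrow> ('v, 'e, 'k) free_alg set" where
  "edge_span 0 = additive_span {scalar c * V v | c v. v \<in> verts G}"
| "edge_span (Suc n) = additive_span {X e * z | e z. e \<in> arcs G \<and> z \<in> edge_span n}"

lemma edge_span_J: "x \<in> J \<Longrightarrow> x \<in> edge_span n"
  by (cases n) (auto intro: additive_span.base)

lemma edge_span_add: "x \<in> edge_span n \<Longrightarrow> y \<in> edge_span n \<Longrightarrow> x + y \<in> edge_span n"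
  by (cases n) (auto intro: additive_span_add)

lemma edge_span_eqv: "x \<approx> y \<Longrightarrow> y \<in> edge_span n \<Longrightarrow> x \<in> edge_span n"
  by (cases n) (auto intro: additive_span_eqv)

lemma scalar_V_edge_span: "v \<in> verts G \<Longrightarrow> scalar c * V v \<in> edge_span 0"
  by (auto intro!: additive_span_incl)

lemma X_edge_span: "e \<in> arcs G \<Longrightarrow> z \<in> edge_span n \<Longrightarrow> X e * z \<in> edge_span (Suc n)"
  by (auto intro!: additive_span_incl)

lemma V_edge_span:
  assumes "z \<in> edge_span n" "v \<in> verts G"
  shows "V v * z \<in> edge_span n"
proof (cases n)
  case 0
  show ?thesis
  proof (use assms(1) in \<open>unfold 0 edge_span.simps\<close>, erule additive_span_lmult, safe)
    fix c w assume w: "w \<in> verts G"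
    have "V v * (scalar c * V w) = scalar c * (V v * V w)" by (rule scalar_left_commute)
    also have "\<dots> \<approx> scalar c * (if v = w then V v else 0)" by (intro eqv_lmult V_V assms w)
    finally have "V v * (scalar c * V w) \<in> edge_span 0"
      by (rule edge_span_eqv) (use scalar_V_edge_span[OF assms(2)] scalar_V_edge_span[OF w] edge_span_J[of 0] in \<open>simp del: edge_span.simps\<close>)
    then show "V v * (scalar c * V w) \<in> additive_span {scalar c * V v |c v. v \<in> verts G}" by simp
  qed
next
  case (Suc m)
  show ?thesis
  proof (use assms(1) in \<open>unfold Suc edge_span.simps\<close>, erule additive_span_lmult, safe)
    fix e z assume e: "e \<in> arcs G" and z: "z \<in> edge_span m"
    have "V v * (X e * z) = V v * X e * z" by (simp add: mult.assoc)
    also have "\<dots> \<approx> (if v = tail G e then X e else 0) * z" by (intro eqv_rmult V_X assms e)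
    finally have "V v * (X e * z) \<in> edge_span (Suc m)"
      by (rule edge_span_eqv) (use X_edge_span[OF e z] edge_span_J[of 0] in \<open>simp del: edge_span.simps\<close>)
    then show "V v * (X e * z) \<in> additive_span {X e * z |e z. e \<in> arcs G \<and> z \<in> edge_span m}" by simp
  qed
qed

lemma edge_span_V:
  assumes "z \<in> edge_span n" "v \<in> verts G"
  shows "z * V v \<in> edge_span n"
  using assms(1)
proof (induction n arbitrary: z)
  case 0
  show ?case
  proof (use 0 in \<open>unfold edge_span.simps\<close>, erule additive_span_rmult, safe)
    fix c w assume w: "w \<in> verts G"
    have "scalar c * V w * V v = scalar c * (V w * V v)" by (simp add: mult.assoc)
    also have "\<dots> \<approx> scalar c * (if w = v then V w else 0)" by (intro eqv_lmult V_V assms w)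
    finally have "scalar c * V w * V v \<in> edge_span 0"
      by (rule edge_span_eqv) (use scalar_V_edge_span[OF assms(2)] scalar_V_edge_span[OF w] edge_span_J[of 0] in \<open>simp del: edge_span.simps\<close>)
    then show "scalar c * V w * V v \<in> additive_span {scalar c * V v |c v. v \<in> verts G}" by simp
  qed
next
  case (Suc m)
  show ?case
  proof (use Suc.prems in \<open>unfold edge_span.simps\<close>, erule additive_span_rmult, safe)
    fix e z assume "e \<in> arcs G" "z \<in> edge_span m"
    then have "X e * (z * V v) \<in> edge_span (Suc m)" by (intro X_edge_span Suc.IH)
    then show "X e * z * V v \<in> additive_span {X e * z |e z. e \<in> arcs G \<and> z \<in> edge_span m}"
      by (simp add: mult.assoc)
  qed
qed

lemma edge_span_X:
  assumes "z \<in> edge_span n" "f \<in> arcs G"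
  shows "z * X f \<in> edge_span (Suc n)"
  using assms(1)
proof (induction n arbitrary: z)
  case 0
  show ?case
  proof (use 0 in \<open>unfold edge_span.simps(1)\<close>, subst edge_span.simps(2), erule additive_span_rmult, safe)
    fix c w assume w: "w \<in> verts G"
    have "scalar c * V w * X f = scalar c * (V w * X f)" by (simp add: mult.assoc)
    \<comment> \<open>The vertex has to move to the right end of f, since a generator of
      \<open>edge_span (Suc 0)\<close> is an edge times an element of degree zero.\<close>
    also have "\<dots> \<approx> scalar c * (if w = tail G f then X f * V (head G f) else 0)"
    proof (rule eqv_lmult)
      have "V w * X f \<approx> (if w = tail G f then X f else 0)" by (intro V_X assms w)
      also have "\<dots> \<approx> (if w = tail G f then X f * V (head G f) else 0)"
        using eqv_sym[OF X_head[OF assms(2)]] by simp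
      finally show "V w * X f \<approx> (if w = tail G f then X f * V (head G f) else 0)" .
    qed
    also have "\<dots> = (if w = tail G f then X f * (scalar c * V (head G f)) else 0)"
      by (simp add: scalar_left_commute)
    finally have "scalar c * V w * X f \<in> edge_span (Suc 0)"
      by (rule edge_span_eqv)
        (use X_edge_span[OF assms(2) scalar_V_edge_span[OF head_in_verts[OF assms(2)]]] edge_span_J[of 0]
          in \<open>simp del: edge_span.simps\<close>)
    then show "scalar c * V w * X f \<in> additive_span {X e * z |e z. e \<in> arcs G \<and> z \<in> edge_span 0}"
      by (simp only: edge_span.simps(2))
  qed
next
  case (Suc m)
  show ?case
  proof (use Suc.prems in \<open>unfold edge_span.simps(2)[of m]\<close>, subst edge_span.simps(2), erule additive_span_rmult, safe)
    fix e z assume "e \<in> arcs G" "z \<in> edge_span m"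
    then have "X e * (z * X f) \<in> edge_span (Suc (Suc m))" by (intro X_edge_span Suc.IH)
    then show "X e * z * X f \<in> additive_span {X e * z |e z. e \<in> arcs G \<and> z \<in> edge_span (Suc m)}"
      by (simp only: mult.assoc edge_span.simps(2)[of "Suc m"])
  qed
qed

lemma Y_X_mult:
  assumes "f \<in> arcs G" "e \<in> arcs G"
  shows "Y f * (X e * z) \<approx> (if f = e then V (head G e) * z else 0)"
proof -
  have "Y f * (X e * z) = Y f * X e * z" by (simp add: mult.assoc)
  also have "\<dots> \<approx> (if f = e then V (head G f) else 0) * z" by (intro eqv_rmult Y_X assms)
  also have "\<dots> = (if f = e then V (head G e) * z else 0)" by simp
  finally show ?thesis .
qed

lemma mult_Y_X:
  assumes "f \<in> arcs G" "e \<in> arcs G"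
  shows "y * Y f * X e \<approx> (if f = e then y * V (head G e) else 0)"
proof -
  have "y * Y f * X e = y * (Y f * X e)" by (simp add: mult.assoc)
  also have "\<dots> \<approx> y * (if f = e then V (head G f) else 0)" by (intro eqv_lmult Y_X assms)
  also have "\<dots> = (if f = e then y * V (head G e) else 0)" by simp
  finally show ?thesis .
qed

lemma Y_edge_span:
  assumes "z \<in> edge_span (Suc n)" "f \<in> arcs G"
  shows "Y f * z \<in> edge_span n"
proof -
  have "\<exists>S. edge_span n = additive_span S" by (cases n) auto
  then obtain S where S: "edge_span n = additive_span S" ..
  have "Y f * (X e * z) \<in> edge_span n" if "e \<in> arcs G" "z \<in> edge_span n" for e z
    using Y_X_mult[OF assms(2) that(1), of z] V_edge_span[OF that(2) head_in_verts[OF that(1)]] edge_span_J[of "Y f * (X e * z)" n]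
    by (auto intro: edge_span_eqv split: if_splits)
  then show ?thesis
    using assms(1) unfolding S edge_span.simps by - (erule additive_span_lmult, auto)
qed

lemma edge_span_Suc_decomposes:
  assumes "z \<in> edge_span (Suc n)"
  shows "decomposes (arcs G) (\<lambda>e z. X e * (Y e * z)) z"
proof (rule decomposes_additive_span[OF assms[unfolded edge_span.simps]], goal_cases)
  case (3 x)
  then obtain e z where e: "e \<in> arcs G" and x: "x = X e * z" by blast
  show ?case
  proof (rule decomposes_single[OF e])
    fix f assume f: "f \<in> arcs G"
    have "X f * (Y f * x) \<approx> X f * (if f = e then V (head G e) * z else 0)"
      unfolding x by (intro eqv_lmult Y_X_mult e f)
    also have "\<dots> = (if f = e then X e * V (head G e) * z else 0)" by (simp add: mult.assoc)
    also have "\<dots> \<approx> (if f = e then x else 0)"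
      using eqv_rmult[OF X_head[OF e], of z] by (simp add: x)
    finally show "X f * (Y f * x) \<approx> (if f = e then x else 0)" .
  qed
qed (auto simp: distrib_left lmult_mem)

lemma edge_span_Suc_mem:
  assumes "z \<in> edge_span (Suc n)" "\<And>e. e \<in> arcs G \<Longrightarrow> Y e * z \<in> J"
  shows "z \<in> J"
  by (rule decomposes_mem[OF edge_span_Suc_decomposes[OF assms(1)]]) (intro lmult_mem assms(2))

text \<open>Sums of vertices act as local units. Prefixing an edge does not touch the right end, so
  the finite set of vertices found for z also serves X e * z.\<close>

lemma edge_span_right_unit:
  assumes "z \<in> edge_span n"
  shows "decomposes (verts G) (\<lambda>v z. z * V v) z"
  using assms
proof (induction n arbitrary: z)
  case 0
  show ?case
  proof (rule decomposes_additive_span[OF 0[unfolded edge_span.simps]], goal_cases)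
    case (3 x)
    then obtain c v where v: "v \<in> verts G" and x: "x = scalar c * V v" by blast
    show ?case
    proof (rule decomposes_single[OF v])
      fix w assume w: "w \<in> verts G"
      have "V v * V v \<approx> V v" using V_V[OF v v] by simp
      then have "x * V v \<approx> x" unfolding x mult.assoc by (rule eqv_lmult)
      then show "x * V w \<approx> (if w = v then x else 0)" using v w by (rule V_mult_right_unit)
    qed
  qed (auto simp: distrib_right rmult_mem)
next
  case (Suc n)
  show ?case
  proof (rule decomposes_additive_span[OF Suc.prems[unfolded edge_span.simps]], goal_cases)
    case (3 x)
    then obtain e z where z: "z \<in> edge_span n" and x: "x = X e * z" by blast
    obtain W where W: "finite W" "W \<subseteq> verts G"
      "\<forall>B. finite B \<and> W \<subseteq> B \<and> B \<subseteq> verts G \<longrightarrow> z \<approx> (\<Sum>v\<in>B. z * V v)"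
      using Suc.IH[OF z] unfolding decomposes_def by (elim exE conjE)
    show ?case unfolding decomposes_def
    proof (intro exI[of _ W] conjI allI impI W)
      fix B assume "finite B \<and> W \<subseteq> B \<and> B \<subseteq> verts G"
      then have "X e * z \<approx> X e * (\<Sum>v\<in>B. z * V v)" using W(3) by (intro eqv_lmult) blast
      then show "x \<approx> (\<Sum>v\<in>B. x * V v)" by (simp add: x sum_distrib_left mult.assoc)
    qed
  qed (auto simp: distrib_right rmult_mem)
qed

text \<open>Vertices are orthogonal, so cutting with v keeps exactly the coefficient of v. It
  matters that both sides give the same c: the product of the two cuts is then c^2 v.\<close>

lemma edge_span_0_V:
  assumes "z \<in> edge_span 0" "v \<in> verts G"
  shows "\<exists>c. z * V v \<approx> scalar c * V v \<and> V v * z \<approx> scalar c * V v"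
  using assms(1)[unfolded edge_span.simps]
proof induction
  case (base x)
  then show ?case by (intro exI[of _ 0]) (simp add: lmult_mem rmult_mem)
next
  case (step x y)
  obtain c w where w: "w \<in> verts G" and x: "x = scalar c * V w" using step(1) by blast
  obtain d where d: "y * V v \<approx> scalar d * V v" "V v * y \<approx> scalar d * V v" using step(3) by blast
  have xv: "x * V v \<approx> scalar (if w = v then c else 0) * V v"
    using eqv_lmult[OF V_V[OF w assms(2)], of "scalar c"] by (auto simp: x mult.assoc split: if_splits)
  have vx: "V v * x \<approx> scalar (if w = v then c else 0) * V v"
    using eqv_lmult[OF V_V[OF assms(2) w], of "scalar c"]
    by (auto simp: x scalar_left_commute[of "V v"] split: if_splits)
  show ?case
    using eqv_add[OF xv d(1)] eqv_add[OF vx d(2)]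
    by (intro exI[of _ "(if w = v then c else 0) + d"]) (simp add: single_add distrib_left distrib_right)
qed

text \<open>Ghost edges on the left strip one edge after another, and \<open>null\<close> survives
  this. What remains is a combination of vertices, where it forces every coefficient to have square
  zero.\<close>

lemma null_edge_span_mem:
  assumes "z \<in> edge_span n" "null z"
  shows "z \<in> J"
  using assms
proof (induction n arbitrary: z)
  case 0
  show ?case
  proof (rule decomposes_mem[OF edge_span_right_unit[OF 0(1)]])
    fix v assume v: "v \<in> verts G"
    obtain c where c: "z * V v \<approx> scalar c * V v" "V v * z \<approx> scalar c * V v"
      using edge_span_0_V[OF 0(1) v] by blast
    \<comment> \<open>The choice r = 1 is enough: v z z v is c^2 v, and a vertex is nonzero.\<close>
    have "z * 1 * z \<in> J" using 0(2) unfolding null_def by blast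
    then have "V v * (z * 1 * z) * V v \<in> J" by (rule rmult_mem[OF lmult_mem])
    then have "(V v * z) * (z * V v) \<in> J" by (simp add: mult.assoc)
    then have "(scalar c * V v) * (scalar c * V v) \<in> J"
      using eqv_mem'[OF eqv_mult[OF c(2,1)]] by blast
    moreover have "(scalar c * V v) * (scalar c * V v) = scalar (c * c) * (V v * V v)"
      by (simp only: mult.assoc scalar_left_commute[of "V v"] scalar_mult_scalar)
    moreover have "scalar (c * c) * (V v * V v) \<approx> scalar (c * c) * V v"
      using eqv_lmult[OF V_V[OF v v]] by simp
    ultimately have "scalar (c * c) * V v \<in> J" using eqv_mem' by metis
    then have "c = 0" using scalar_V_mem_iff[OF v] by simp
    then show "z * V v \<in> J" using c(1) by simp
  qed
next
  case (Suc n)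
  show ?case
  proof (rule edge_span_Suc_mem[OF Suc.prems(1)])
    fix e assume "e \<in> arcs G"
    then show "Y e * z \<in> J" by (intro Suc.IH Y_edge_span[OF Suc.prems(1)] null_lmult Suc.prems(2))
  qed
qed

text \<open>Multiplying by f* on the right would not undo f, as f f* need not equal s(f). Instead
  the edges of z are stripped from the left until a scalar c is left, and then f* (c f) = c r(f)
  shows c = 0.\<close>

lemma edge_span_X_cancel:
  assumes "z \<in> edge_span n" "f \<in> arcs G" "z * X f \<in> J"
  shows "z * V (tail G f) \<in> J"
  using assms(1,3)
proof (induction n arbitrary: z)
  case 0
  note w = tail_in_verts[OF assms(2)]
  obtain c where c: "z * V (tail G f) \<approx> scalar c * V (tail G f)"
    using edge_span_0_V[OF 0(1) w] by blast
  have "z * X f \<approx> z * V (tail G f) * X f"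
    unfolding mult.assoc by (rule eqv_lmult[OF eqv_sym[OF tail_X[OF assms(2)]]])
  also have "\<dots> \<approx> scalar c * V (tail G f) * X f" by (rule eqv_rmult[OF c])
  also have "\<dots> \<approx> scalar c * X f"
    unfolding mult.assoc by (rule eqv_lmult[OF tail_X[OF assms(2)]])
  finally have "scalar c * X f \<in> J" using 0(2) by (rule eqv_mem')
  then have "Y f * (scalar c * X f) \<in> J" by (rule lmult_mem)
  then have "scalar c * (Y f * X f) \<in> J" by (simp only: scalar_left_commute)
  moreover have "scalar c * (Y f * X f) \<approx> scalar c * V (head G f)"
    using eqv_lmult[OF Y_X[OF assms(2,2)]] by simp
  ultimately have "scalar c * V (head G f) \<in> J" using eqv_mem' by blast
  then have "c = 0" using scalar_V_mem_iff[OF head_in_verts[OF assms(2)]] by simp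
  then show ?case using c by simp
next
  case (Suc n)
  show ?case
  proof (rule edge_span_Suc_mem)
    show "z * V (tail G f) \<in> edge_span (Suc n)"
      by (rule edge_span_V[OF Suc.prems(1) tail_in_verts[OF assms(2)]])
    fix e assume e: "e \<in> arcs G"
    have "Y e * z * X f \<in> J" unfolding mult.assoc by (rule lmult_mem[OF Suc.prems(2)])
    then have "Y e * z * V (tail G f) \<in> J" by (rule Suc.IH[OF Y_edge_span[OF Suc.prems(1) e]])
    then show "Y e * (z * V (tail G f)) \<in> J" by (simp add: mult.assoc)
  qed
qed

text \<open>There are no ghost-free elements of negative degree.\<close>

definition edge_component :: "int \<Rightarrow> ('v, 'e, 'k) free_alg set" where
  "edge_component n = (if n < 0 then J else edge_span (nat n))"

lemma edge_component_J: "x \<in> J \<Longrightarrow> x \<in> edge_component n"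
  by (simp add: edge_component_def edge_span_J)

lemma edge_component_add: "x \<in> edge_component n \<Longrightarrow> y \<in> edge_component n \<Longrightarrow> x + y \<in> edge_component n"
  by (auto simp: edge_component_def intro: edge_span_add add_mem)

lemma edge_component_eqv: "x \<approx> y \<Longrightarrow> y \<in> edge_component n \<Longrightarrow> x \<in> edge_component n"
  by (auto simp: edge_component_def intro: edge_span_eqv eqv_mem)

lemma edge_component_V: "z \<in> edge_component n \<Longrightarrow> v \<in> verts G \<Longrightarrow> z * V v \<in> edge_component n"
  by (auto simp: edge_component_def intro: edge_span_V rmult_mem)

text \<open>The only change of regime is n = -1, where an element of \<open>J\<close> has to land in
  \<open>edge_span 0\<close>, which contains \<open>J\<close>.\<close>

lemma edge_component_X: "z \<in> edge_component n \<Longrightarrow> f \<in> arcs G \<Longrightarrow> z * X f \<in> edge_component (n + 1)"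
  using edge_span_X[of z "nat n" f] edge_span_J[of "z * X f"] rmult_mem[of z "X f"]
  by (auto simp: edge_component_def nat_add_distrib simp del: edge_span.simps split: if_splits)

lemma edge_component_right_unit: "z \<in> edge_component n \<Longrightarrow> decomposes (verts G) (\<lambda>v z. z * V v) z"
  using edge_span_right_unit edge_span_J[of z 0]
  by (auto simp: edge_component_def simp del: edge_span.simps split: if_splits)

lemma null_edge_component_mem: "z \<in> edge_component n \<Longrightarrow> null z \<Longrightarrow> z \<in> J"
  using null_edge_span_mem by (auto simp: edge_component_def split: if_splits)

lemma edge_component_X_cancel:
  "z \<in> edge_component n \<Longrightarrow> f \<in> arcs G \<Longrightarrow> z * X f \<in> J \<Longrightarrow> z * V (tail G f) \<in> J"
  using edge_span_X_cancel by (auto simp: edge_component_def rmult_mem split: if_splits)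

text \<open>
  Elements of degree \<open>n\<close> that are combinations of $\alpha \beta^*$ with $|\beta| \le m$.
\<close>

primrec filtration :: "nat \<Rightarrow> int \<Rightarrow> ('v, 'e, 'k) free_alg set" where
  "filtration 0 n = edge_component n"
| "filtration (Suc m) n = {z + d | z d. z \<in> edge_component n \<and>
     d \<in> additive_span {y * Y e | y e. e \<in> arcs G \<and> y \<in> filtration m (n + 1)}}"

abbreviation ghost_span :: "nat \<Rightarrow> int \<Rightarrow> ('v, 'e, 'k) free_alg set" where
  "ghost_span m n \<equiv> additive_span {y * Y e | y e. e \<in> arcs G \<and> y \<in> filtration m (n + 1)}"

section \<open>The filtration by the length of the ghost part\<close>

lemma filtration_SucI:
  "z \<in> edge_component n \<Longrightarrow> d \<in> ghost_span m n \<Longrightarrow> z + d \<in> filtration (Suc m) n"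
  by auto

lemma filtration_SucE:
  assumes "x \<in> filtration (Suc m) n"
  obtains z d where "x = z + d" "z \<in> edge_component n" "d \<in> ghost_span m n"
  using assms by auto

lemma edge_component_filtration: "z \<in> edge_component n \<Longrightarrow> z \<in> filtration m n"
  using filtration_SucI[OF _ additive_span.base[OF zero_mem], of z n]
  by (cases m) (simp_all del: filtration.simps(2))

lemma filtration_J: "x \<in> J \<Longrightarrow> x \<in> filtration m n"
  by (intro edge_component_filtration edge_component_J)

lemma filtration_add:
  assumes "x \<in> filtration m n" "y \<in> filtration m n"
  shows "x + y \<in> filtration m n"
proof (cases m)
  case (Suc k)
  obtain z d where x: "x = z + d" "z \<in> edge_component n" "d \<in> ghost_span k n"
    using assms(1) unfolding Suc by (rule filtration_SucE)
  obtain z' d' where y: "y = z' + d'" "z' \<in> edge_component n" "d' \<in> ghost_span k n"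
    using assms(2) unfolding Suc by (rule filtration_SucE)
  have "(z + z') + (d + d') \<in> filtration (Suc k) n"
    by (intro filtration_SucI edge_component_add additive_span_add x y)
  then show ?thesis unfolding x(1) y(1) Suc by (simp add: algebra_simps)
qed (use assms edge_component_add in auto)

lemma filtration_eqv:
  assumes "x \<approx> y" "y \<in> filtration m n"
  shows "x \<in> filtration m n"
  using filtration_add[OF filtration_J[of "x - y"] assms(2)] assms(1) by (simp add: eqv_def)

lemma filtration_Suc: "x \<in> filtration m n \<Longrightarrow> x \<in> filtration (Suc m) n"
proof (induction m arbitrary: x n)
  case 0
  then show ?case by (intro edge_component_filtration) simp
next
  case (Suc m)
  obtain z d where x: "x = z + d" "z \<in> edge_component n" "d \<in> ghost_span m n"
    using Suc.prems by (rule filtration_SucE)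
  have "ghost_span m n \<subseteq> ghost_span (Suc m) n"
    by (rule additive_span_mono, rule additive_span_incl) (use Suc.IH in \<open>blast\<close>)
  then show ?case using x filtration_SucI by blast
qed

lemma filtration_mono: "m \<le> k \<Longrightarrow> x \<in> filtration m n \<Longrightarrow> x \<in> filtration k n"
  by (induction k rule: dec_induct) (auto intro: filtration_Suc simp del: filtration.simps)

lemma filtration_Y:
  assumes "x \<in> filtration m n" "e \<in> arcs G"
  shows "x * Y e \<in> filtration (Suc m) (n - 1)"
proof -
  have "x * Y e \<in> ghost_span m (n - 1)"
    using assms by (intro additive_span_incl) auto
  then have "0 + x * Y e \<in> filtration (Suc m) (n - 1)"
    by (intro filtration_SucI edge_component_J zero_mem)
  then show ?thesis by (simp only: add_0_left)
qed

lemma ghost_span_V: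
  assumes "d \<in> ghost_span m n" "v \<in> verts G"
  shows "d * V v \<in> ghost_span m n"
proof (rule additive_span_rmult[OF assms(1)], safe)
  fix y e assume e: "e \<in> arcs G" and y: "y \<in> filtration m (n + 1)"
  have "y * Y e * V v \<approx> y * (if v = tail G e then Y e else 0)"
    unfolding mult.assoc by (intro eqv_lmult Y_V e assms)
  then show "y * Y e * V v \<in> ghost_span m n"
    by (rule additive_span_eqv) (use e y in \<open>auto intro: additive_span_incl additive_span.base\<close>)
qed

lemma filtration_V:
  assumes "x \<in> filtration m n" "v \<in> verts G"
  shows "x * V v \<in> filtration m n"
proof (cases m)
  case (Suc k)
  obtain z d where x: "x = z + d" "z \<in> edge_component n" "d \<in> ghost_span k n"
    using assms(1) unfolding Suc by (rule filtration_SucE)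
  show ?thesis unfolding x(1) Suc distrib_right
    by (intro filtration_SucI edge_component_V ghost_span_V x assms)
qed (use assms edge_component_V in auto)

text \<open>The gain that drives the main induction: relation (3) cancels the last ghost edge of
  each term against f or kills the term, so the index drops from \<open>Suc m\<close> to
  \<open>m\<close>.\<close>

lemma ghost_span_X:
  assumes "d \<in> ghost_span m n" "f \<in> arcs G"
  shows "d * X f \<in> filtration m (n + 1)"
  using assms(1)
proof induction
  case (base x)
  then show ?case by (intro filtration_J rmult_mem)
next
  case (step x d)
  then obtain y e where e: "e \<in> arcs G" and y: "y \<in> filtration m (n + 1)" and x: "x = y * Y e"
    by blast
  have "x * X f \<approx> (if e = f then y * V (head G f) else 0)"
    unfolding x by (rule mult_Y_X[OF e assms(2)])
  then have "x * X f \<in> filtration m (n + 1)"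
    by (rule filtration_eqv)
      (use filtration_V[OF y head_in_verts[OF assms(2)]] filtration_J[of 0] in \<open>simp del: filtration.simps\<close>)
  then show ?case unfolding distrib_right by (rule filtration_add[OF _ step.IH])
qed

text \<open>The mirror image of \<open>edge_span_Suc_decomposes\<close>: a term y e* is fixed by e
  e* on the right and killed by f f* for all other f. So d is determined by the products d
  e.\<close>

lemma ghost_span_decomposes:
  assumes "d \<in> ghost_span m n"
  shows "decomposes (arcs G) (\<lambda>e d. d * X e * Y e) d"
proof (rule decomposes_additive_span[OF assms], goal_cases)
  case (3 x)
  then obtain e y where e: "e \<in> arcs G" and x: "x = y * Y e" by blast
  show ?case
  proof (rule decomposes_single[OF e])
    fix f assume f: "f \<in> arcs G"
    have "x * X f * Y f \<approx> (if e = f then y * V (head G f) else 0) * Y f"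
      unfolding x by (intro eqv_rmult mult_Y_X e f)
    also have "\<dots> = (if f = e then y * (V (head G e) * Y e) else 0)" by (simp add: mult.assoc)
    also have "\<dots> \<approx> (if f = e then x else 0)"
      using eqv_lmult[OF head_Y[OF e], of y] by (simp add: x)
    finally show "x * X f * Y f \<approx> (if f = e then x else 0)" .
  qed
qed (auto simp: distrib_right rmult_mem)

text \<open>Only finitely many edges end the terms of d, and all others annihilate it. At an
  infinite emitter this leaves an edge f for which x f depends on the ghost-free part alone.\<close>

lemma ghost_span_finitely_many_X:
  assumes "d \<in> ghost_span m n"
  obtains W where "finite W" "\<And>f. f \<in> arcs G - W \<Longrightarrow> d * X f \<in> J"
proof -
  obtain W where W: "finite W" "W \<subseteq> arcs G" "d \<approx> (\<Sum>e\<in>W. d * X e * Y e)"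
    by (rule decomposes_eqv_sum[OF ghost_span_decomposes[OF assms]])
  have "d * X f \<in> J" if f: "f \<in> arcs G - W" for f
  proof (rule eqv_mem[OF eqv_rmult[OF W(3)]], unfold sum_distrib_right, rule sum_mem)
    fix e assume "e \<in> W"
    then have "e \<in> arcs G" "f \<in> arcs G" "e \<noteq> f" using W(2) f by auto
    then have "d * X e * Y e * X f \<approx> 0"
      using mult_Y_X[of e f "d * X e"] by simp
    then show "d * X e * Y e * X f \<in> J" by simp
  qed
  then show thesis using W(1) that by blast
qed

lemma ghost_span_right_unit:
  assumes "d \<in> ghost_span m n"
  shows "decomposes (verts G) (\<lambda>v d. d * V v) d"
proof (rule decomposes_additive_span[OF assms], goal_cases)
  case (3 x)
  then obtain e y where e: "e \<in> arcs G" and x: "x = y * Y e" by blast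
  show ?case
  proof (rule decomposes_single[OF tail_in_verts[OF e]])
    fix v assume v: "v \<in> verts G"
    have "x * V (tail G e) \<approx> x"
      unfolding x mult.assoc by (rule eqv_lmult[OF Y_tail[OF e]])
    then show "x * V v \<approx> (if v = tail G e then x else 0)"
      using tail_in_verts[OF e] v by (rule V_mult_right_unit)
  qed
qed (auto simp: distrib_right rmult_mem)

lemma null_filtration_mem:
  assumes "x \<in> filtration m n" "null x"
  shows "x \<in> J"
  using assms
proof (induction m arbitrary: x n)
  case 0
  then show ?case using null_edge_component_mem by simp
next
  case (Suc m)
  obtain z d where x: "x = z + d" and z: "z \<in> edge_component n" and d: "d \<in> ghost_span m n"
    using Suc.prems(1) by (rule filtration_SucE)
  have xX: "x * X e \<in> J" if e: "e \<in> arcs G" for e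
  proof (rule Suc.IH)
    show "x * X e \<in> filtration m (n + 1)"
      unfolding x distrib_right
      by (intro filtration_add edge_component_filtration edge_component_X ghost_span_X z d e)
    show "null (x * X e)" by (rule null_rmult[OF Suc.prems(2)])
  qed
  have xV: "x * V v \<in> J" if v: "v \<in> verts G" for v
  proof (cases "v \<in> regular_verts G")
    case True
    have "x * V v \<approx> x * (\<Sum>e\<in>out_arcs G v. X e * Y e)" by (rule eqv_lmult[OF V_regular[OF True]])
    also have "\<dots> = (\<Sum>e\<in>out_arcs G v. x * X e * Y e)" by (simp add: sum_distrib_left mult.assoc)
    also have "\<dots> \<approx> 0"
      using rmult_mem[OF xX] by (auto intro!: sum_mem)
    finally show ?thesis by simp
  next
    case False
    \<comment> \<open>Once z v vanishes, d v and x v agree, so d v e equals x e for e leaving v and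
      is zero for all other e. The products d v e determine d v.\<close>
    have dV: "d * V v \<in> J" if zV: "z * V v \<in> J"
    proof (rule decomposes_mem[OF ghost_span_decomposes[OF ghost_span_V[OF d v]]], rule rmult_mem)
      fix e assume e: "e \<in> arcs G"
      have V_e: "V v * X e \<approx> (if v = tail G e then X e else 0)" by (rule V_X[OF e e v])
      show "d * V v * X e \<in> J"
      proof (cases "v = tail G e")
        case True
        have "z * V v * X e \<in> J" by (rule rmult_mem[OF zV])
        moreover have "x * V v * X e \<in> J"
          using eqv_mem[OF eqv_lmult[OF V_e, of x]] xX[OF e] True by (simp add: mult.assoc)
        ultimately have "x * V v * X e - z * V v * X e \<in> J" by (intro diff_mem)
        then show ?thesis by (simp add: x algebra_simps)
      next
        case False
        then show ?thesis using eqv_lmult[OF V_e, of d] by (simp add: mult.assoc)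
      qed
    qed
    show ?thesis
    proof (cases "out_arcs G v = {}")
      case True
      \<comment> \<open>At a sink no edge leaves v, so all products d v e vanish and with them d v.
        Then x v is congruent to the ghost-free z v, to which the ghost-free case applies.\<close>
      have dv: "d * V v \<in> J"
      proof (rule decomposes_mem[OF ghost_span_decomposes[OF ghost_span_V[OF d v]]], rule rmult_mem)
        fix e assume e: "e \<in> arcs G"
        then have "v \<noteq> tail G e" using True by auto
        then show "d * V v * X e \<in> J" using eqv_lmult[OF V_X[OF e e v], of d] by (simp add: mult.assoc)
      qed
      then have "x * V v \<approx> z * V v" by (simp add: x eqv_def algebra_simps)
      then have "null (z * V v)" using null_eqv null_rmult[OF Suc.prems(2)] by blast
      then have "z * V v \<in> J" by (rule null_edge_component_mem[OF edge_component_V[OF z v]])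
      then show ?thesis using dv add_mem by (simp add: x distrib_right)
    next
      case False
      then have inf: "infinite (out_arcs G v)"
        using \<open>v \<notin> regular_verts G\<close> v by (auto simp: regular_verts_def)
      obtain W where W: "finite W" "\<And>f. f \<in> arcs G - W \<Longrightarrow> d * X f \<in> J"
        using ghost_span_finitely_many_X[OF d] by blast
      obtain f where f: "f \<in> out_arcs G v" "f \<notin> W"
        using Diff_infinite_finite[OF W(1) inf] by (metis Diff_iff finite.emptyI ex_in_conv)
      then have f': "f \<in> arcs G" "tail G f = v" by auto
      have "x * X f - d * X f \<in> J" using xX[OF f'(1)] W(2) f f'(1) by (intro diff_mem) auto
      \<comment> \<open>Here x f is zero by the induction hypothesis and d f by the choice of f,
        which isolates z f.\<close>
      then have "z * X f \<in> J" by (simp add: x algebra_simps)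
      then have "z * V v \<in> J" using edge_component_X_cancel[OF z f'(1)] f'(2) by simp
      then show ?thesis using dV add_mem by (simp add: x distrib_right)
    qed
  qed
  obtain W where W: "finite W" "W \<subseteq> verts G" "\<forall>B. finite B \<and> W \<subseteq> B \<and> B \<subseteq> verts G \<longrightarrow> z \<approx> (\<Sum>v\<in>B. z * V v)"
    using edge_component_right_unit[OF z] unfolding decomposes_def by (elim exE conjE)
  obtain W' where W': "finite W'" "W' \<subseteq> verts G" "\<forall>B. finite B \<and> W' \<subseteq> B \<and> B \<subseteq> verts G \<longrightarrow> d \<approx> (\<Sum>v\<in>B. d * V v)"
    using ghost_span_right_unit[OF d] unfolding decomposes_def by (elim exE conjE)
  \<comment> \<open>The two parts of x may need different vertices, so both are cut along the union;
    finitely many cuts x v then recover x.\<close>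
  have "x \<approx> (\<Sum>v\<in>W \<union> W'. z * V v) + (\<Sum>v\<in>W \<union> W'. d * V v)"
    unfolding x using W W' by (intro eqv_add) auto
  also have "\<dots> = (\<Sum>v\<in>W \<union> W'. x * V v)" by (simp add: x sum.distrib distrib_right)
  finally show ?case using xV W(2) W'(2) by (meson eqv_mem sum_mem Un_least subsetD)
qed

end

section \<open>From words to the filtration and to the monomials alpha beta*\<close>

lemma poly_mapping_sum_keys: "(\<Sum>k\<in>Poly_Mapping.keys x. Poly_Mapping.single k (Poly_Mapping.lookup x k)) = x"
proof (rule poly_mapping_eqI)
  fix k
  have "Poly_Mapping.lookup (\<Sum>k\<in>Poly_Mapping.keys x. Poly_Mapping.single k (Poly_Mapping.lookup x k)) k
      = (\<Sum>k'\<in>Poly_Mapping.keys x. if k' = k then Poly_Mapping.lookup x k' else 0)"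
    by (simp add: lookup_sum lookup_single when_def)
  also have "\<dots> = Poly_Mapping.lookup x k" by (simp add: in_keys_iff)
  finally show "Poly_Mapping.lookup (\<Sum>k\<in>Poly_Mapping.keys x. Poly_Mapping.single k (Poly_Mapping.lookup x k)) k
      = Poly_Mapping.lookup x k" .
qed

lemma single_snoc: "Poly_Mapping.single (Word (ls @ [g])) c = Poly_Mapping.single (Word ls) c * gen g"
  by (simp add: gen_def mult_single plus_free_word_def)

lemma word_degree_snoc: "word_degree (Word (ls @ [g])) = word_degree (Word ls) + letter_degree g"
  by (simp add: word_degree_def)

text \<open>The representative used in \<open>lpa_path\<close>, named separately so that it can be
  handled in the free algebra before cosets are taken.\<close>

definition path_monomial :: "'v \<times> 'e list \<Rightarrow> ('v, 'e, 'k :: field) free_alg" where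
  "path_monomial \<alpha> =
     (case \<alpha> of (v, []) \<Rightarrow> vertex_gen v | (v, e # p) \<Rightarrow> prod_list (map edge_gen (e # p)))"

definition ghost_monomial :: "'v \<times> 'e list \<Rightarrow> ('v, 'e, 'k :: field) free_alg" where
  "ghost_monomial \<alpha> =
     (case \<alpha> of (v, []) \<Rightarrow> vertex_gen v | (v, e # p) \<Rightarrow> prod_list (map ghost_gen (rev (e # p))))"

lemma path_monomial_simps [simp]:
  "path_monomial (v, []) = vertex_gen v"
  "path_monomial (v, e # p) = edge_gen e * prod_list (map edge_gen p)"
  by (simp_all add: path_monomial_def)

lemma ghost_monomial_simps [simp]:
  "ghost_monomial (v, []) = vertex_gen v"
  "ghost_monomial (v, e # p) = prod_list (map ghost_gen (rev p)) * ghost_gen e"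
  by (simp_all add: ghost_monomial_def)

context leavitt_quotient
begin

lemma filtration_X:
  assumes "x \<in> filtration m n" "e \<in> arcs G"
  shows "x * X e \<in> filtration m (n + 1)"
proof (cases m)
  case 0
  then show ?thesis using assms edge_component_X by simp
next
  case (Suc k)
  obtain z d where x: "x = z + d" "z \<in> edge_component n" "d \<in> ghost_span k n"
    using assms(1) unfolding Suc by (rule filtration_SucE)
  show ?thesis unfolding x(1) Suc distrib_right
    by (intro filtration_add edge_component_filtration edge_component_X filtration_Suc ghost_span_X x assms)
qed

text \<open>Induction over words has to start with one letter, because the empty word is the unit of
  the free algebra and need not be a combination of vertices modulo \<open>J\<close>. An edge or
  ghost edge gets its source in front, so that it becomes a right multiple of a vertex.\<close>

lemma gen_filtration:
  "\<exists>m. scalar c * gen g \<in> filtration m (letter_degree g)"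
proof (cases "g \<in> generators G")
  case True
  have V: "scalar c * V v \<in> edge_component 0" if "v \<in> verts G" for v
    using scalar_V_edge_span[OF that] by (simp add: edge_component_def)
  show ?thesis
  proof (cases g)
    case (Vertex v)
    then have "v \<in> verts G" using True by (auto simp: generators_def)
    then have "scalar c * gen g \<in> filtration 0 (letter_degree g)" using V Vertex by simp
    then show ?thesis ..
  next
    case (Edge e)
    then have e: "e \<in> arcs G" using True by (auto simp: generators_def)
    have "scalar c * X e \<approx> scalar c * (V (tail G e) * X e)" by (rule eqv_lmult[OF eqv_sym[OF tail_X[OF e]]])
    also have "\<dots> = scalar c * V (tail G e) * X e" by (simp add: mult.assoc)
    finally have "scalar c * X e \<in> edge_component (0 + 1)"
      by (rule edge_component_eqv) (intro edge_component_X V e tail_in_verts)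
    then have "scalar c * gen g \<in> filtration 0 (letter_degree g)" using Edge by simp
    then show ?thesis ..
  next
    case (Ghost e)
    then have e: "e \<in> arcs G" using True by (auto simp: generators_def)
    have "scalar c * Y e \<approx> scalar c * (V (head G e) * Y e)" by (rule eqv_lmult[OF eqv_sym[OF head_Y[OF e]]])
    also have "\<dots> = scalar c * V (head G e) * Y e" by (simp add: mult.assoc)
    finally have "scalar c * Y e \<in> filtration (Suc 0) (0 - 1)"
      by (rule filtration_eqv) (intro filtration_Y edge_component_filtration V e head_in_verts)
    then have "scalar c * gen g \<in> filtration (Suc 0) (letter_degree g)" using Ghost by simp
    then show ?thesis ..
  qed
qed (auto intro: filtration_J lmult_mem outside)

lemma filtration_gen:
  assumes "x \<in> filtration m n"
  shows "\<exists>k. x * gen g \<in> filtration k (n + letter_degree g)"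
proof (cases "g \<in> generators G")
  case True
  show ?thesis
  proof (cases g)
    case (Vertex v)
    then have "v \<in> verts G" using True by (auto simp: generators_def)
    then show ?thesis using filtration_V[OF assms] Vertex by auto
  next
    case (Edge e)
    then have "e \<in> arcs G" using True by (auto simp: generators_def)
    then show ?thesis using filtration_X[OF assms] Edge by auto
  next
    case (Ghost e)
    then have "e \<in> arcs G" using True by (auto simp: generators_def)
    then have "x * gen g \<in> filtration (Suc m) (n + letter_degree g)"
      using filtration_Y[OF assms, of e] Ghost by (simp del: filtration.simps)
    then show ?thesis ..
  qed
qed (auto intro: filtration_J lmult_mem outside)

lemma single_filtration:
  assumes "letters w \<noteq> []"
  shows "\<exists>m. Poly_Mapping.single w c \<in> filtration m (word_degree w)"
proof -
  have "\<exists>m. Poly_Mapping.single (Word ls) c \<in> filtration m (word_degree (Word ls))" if "ls \<noteq> []" for ls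
    using that
  proof (induction ls rule: rev_induct)
    case (snoc g ls)
    show ?case
    proof (cases "ls = []")
      case True
      have "Poly_Mapping.single (Word [g]) c = scalar c * gen g"
        by (simp add: gen_def mult_single)
      then show ?thesis using gen_filtration[of c g] True by (simp add: word_degree_def)
    next
      case False
      then obtain m where "Poly_Mapping.single (Word ls) c \<in> filtration m (word_degree (Word ls))"
        using snoc by blast
      then show ?thesis unfolding single_snoc word_degree_snoc by (rule filtration_gen)
    qed
  qed simp
  from this[of "letters w"] show ?thesis using assms by simp
qed

text \<open>The words of x may require different bounds on the ghost part; as the filtration
  increases, the maximum serves them all.\<close>

lemma homogeneous_filtration:
  assumes "\<And>w. w \<in> Poly_Mapping.keys x \<Longrightarrow> letters w \<noteq> [] \<and> word_degree w = n"
  shows "\<exists>m. x \<in> filtration m n"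
proof -
  have "\<exists>m. (\<Sum>w\<in>S. Poly_Mapping.single w (Poly_Mapping.lookup x w)) \<in> filtration m n"
    if "finite S" "S \<subseteq> Poly_Mapping.keys x" for S
    using that
  proof (induction S rule: finite_induct)
    case empty
    then show ?case using filtration_J[OF zero_mem] by (simp del: filtration.simps)
  next
    case (insert w S)
    obtain m where m: "(\<Sum>w\<in>S. Poly_Mapping.single w (Poly_Mapping.lookup x w)) \<in> filtration m n"
      using insert by blast
    have "w \<in> Poly_Mapping.keys x" using insert.prems by blast
    then obtain k where "Poly_Mapping.single w (Poly_Mapping.lookup x w) \<in> filtration k n"
      using single_filtration[of w "Poly_Mapping.lookup x w"] assms[of w] by metis
    then have "Poly_Mapping.single w (Poly_Mapping.lookup x w)
        + (\<Sum>w\<in>S. Poly_Mapping.single w (Poly_Mapping.lookup x w)) \<in> filtration (max m k) n"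
      using m by (intro filtration_add) (rule filtration_mono[rotated], assumption, simp)+
    then show ?case using insert(1,2) by (simp del: filtration.simps) blast
  qed
  from this[of "Poly_Mapping.keys x"] show ?thesis by (simp add: poly_mapping_sum_keys)
qed

theorem null_homogeneous_mem:
  assumes "\<And>w. w \<in> Poly_Mapping.keys x \<Longrightarrow> letters w \<noteq> [] \<and> word_degree w = n"
    and "null x"
  shows "x \<in> J"
  using homogeneous_filtration[OF assms(1)] null_filtration_mem assms(2) by blast

lemma in_paths_iff: "(u, p) \<in> paths G \<longleftrightarrow> (\<exists>v. awalk u p v)"
  by (simp add: paths_def)

lemma Cons_in_paths_iff:
  "(u, e # p) \<in> paths G \<longleftrightarrow> e \<in> arcs G \<and> u = tail G e \<and> (head G e, p) \<in> paths G"
  by (auto simp: in_paths_iff awalk_Cons_iff)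

lemma Nil_in_paths_iff: "(u, []) \<in> paths G \<longleftrightarrow> u \<in> verts G"
  by (auto simp: in_paths_iff awalk_Nil_iff)

lemma path_source_in_verts: "(u, p) \<in> paths G \<Longrightarrow> u \<in> verts G"
  by (auto simp: in_paths_iff awalk_def)

lemma V_path_monomial: "(u, p) \<in> paths G \<Longrightarrow> V u * path_monomial (u, p) \<approx> path_monomial (u, p)"
proof (cases p)
  case Nil
  then show "(u, p) \<in> paths G \<Longrightarrow> ?thesis" using V_V[of u u] by (simp add: Nil_in_paths_iff)
next
  case (Cons e q)
  then show "(u, p) \<in> paths G \<Longrightarrow> ?thesis"
    using eqv_rmult[OF tail_X[of e]] by (simp add: Cons_in_paths_iff mult.assoc)
qed

lemma ghost_monomial_V: "(u, p) \<in> paths G \<Longrightarrow> ghost_monomial (u, p) * V u \<approx> ghost_monomial (u, p)"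
proof (cases p)
  case Nil
  then show "(u, p) \<in> paths G \<Longrightarrow> ?thesis" using V_V[of u u] by (simp add: Nil_in_paths_iff)
next
  case (Cons e q)
  then show "(u, p) \<in> paths G \<Longrightarrow> ?thesis"
    using eqv_lmult[OF Y_tail[of e]] by (simp add: Cons_in_paths_iff mult.assoc)
qed

lemma path_monomial_right_unit:
  "(u, p) \<in> paths G \<Longrightarrow> \<exists>v\<in>verts G. path_monomial (u, p) * V v \<approx> path_monomial (u, p)"
proof (induction p arbitrary: u)
  case Nil
  then show ?case using V_V[of u u] by (auto simp: Nil_in_paths_iff)
next
  case (Cons e q)
  then have e: "e \<in> arcs G" and q: "(head G e, q) \<in> paths G" by (auto simp: Cons_in_paths_iff)
  show ?case
  \<comment> \<open>A one-edge path needs its own case: the monomial of an empty path is a vertex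
    and not 1, so \<open>X e\<close> is not literally \<open>X e\<close> times the monomial of the
    rest.\<close>
  proof (cases "q = []")
    case True
    then show ?thesis using X_head[OF e] head_in_verts[OF e] by auto
  next
    case False
    then have *: "path_monomial (u, e # q) = X e * path_monomial (head G e, q)" by (cases q) auto
    obtain v where v: "v \<in> verts G" "path_monomial (head G e, q) * V v \<approx> path_monomial (head G e, q)"
      using Cons.IH[OF q] by blast
    show ?thesis unfolding * mult.assoc using v(1) eqv_lmult[OF v(2)] by blast
  qed
qed

lemma X_path_monomial:
  assumes "e \<in> arcs G" "(u, p) \<in> paths G"
  shows "X e * path_monomial (u, p) \<approx> (if u = head G e then path_monomial (tail G e, e # p) else 0)"
proof -
  have "X e * path_monomial (u, p) \<approx> X e * (V u * path_monomial (u, p))"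
    by (rule eqv_lmult[OF eqv_sym[OF V_path_monomial[OF assms(2)]]])
  also have "\<dots> = X e * V u * path_monomial (u, p)" by (simp add: mult.assoc)
  also have "\<dots> \<approx> (if u = head G e then X e else 0) * path_monomial (u, p)"
    by (rule eqv_rmult[OF X_V[OF assms(1) assms(1) path_source_in_verts[OF assms(2)]]])
  also have "\<dots> \<approx> (if u = head G e then path_monomial (tail G e, e # p) else 0)"
    using X_head[OF assms(1)] by (cases p) auto
  finally show ?thesis .
qed

lemma ghost_monomial_Y:
  assumes "e \<in> arcs G" "(u, p) \<in> paths G"
  shows "ghost_monomial (u, p) * Y e \<approx> (if u = head G e then ghost_monomial (tail G e, e # p) else 0)"
proof -
  have "ghost_monomial (u, p) * Y e \<approx> ghost_monomial (u, p) * V u * Y e"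
    by (rule eqv_rmult[OF eqv_sym[OF ghost_monomial_V[OF assms(2)]]])
  also have "\<dots> = ghost_monomial (u, p) * (V u * Y e)" by (simp add: mult.assoc)
  also have "\<dots> \<approx> ghost_monomial (u, p) * (if u = head G e then Y e else 0)"
    by (rule eqv_lmult[OF V_Y[OF assms(1) assms(1) path_source_in_verts[OF assms(2)]]])
  also have "\<dots> \<approx> (if u = head G e then ghost_monomial (tail G e, e # p) else 0)"
    using head_Y[OF assms(1)] by (cases p) auto
  finally show ?thesis .
qed

abbreviation component_span :: "int \<Rightarrow> ('v, 'e, 'k) free_alg set" where
  "component_span n \<equiv> additive_span {scalar c * (path_monomial \<alpha> * ghost_monomial \<beta>) | c \<alpha> \<beta>.
     \<alpha> \<in> paths G \<and> \<beta> \<in> paths G \<and> int (path_length \<alpha>) - int (path_length \<beta>) = n}"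

text \<open>Words of edges that do not compose are discarded here: by
  \<open>X_path_monomial\<close>, prefixing an edge gives a path or zero.\<close>

lemma edge_span_path_monomials:
  "edge_span n \<subseteq> additive_span {scalar c * path_monomial \<alpha> | c \<alpha>. \<alpha> \<in> paths G \<and> path_length \<alpha> = n}"
    (is "_ \<subseteq> ?S n")
proof (induction n)
  case 0
  show ?case unfolding edge_span.simps
  proof (rule additive_span_mono, rule additive_span_incl, safe)
    fix c v assume "v \<in> verts G"
    then show "\<exists>c' \<alpha>. scalar c * V v = scalar c' * path_monomial \<alpha> \<and> \<alpha> \<in> paths G \<and> path_length \<alpha> = 0"
      by (intro exI[of _ c] exI[of _ "(v, [])"]) (simp add: Nil_in_paths_iff path_length_def)
  qed
next
  case (Suc n)
  show ?case unfolding edge_span.simps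
  proof (rule additive_span_mono, safe)
    fix e z assume e: "e \<in> arcs G" and z: "z \<in> edge_span n"
    have "z \<in> ?S n" using z Suc by blast
    then show "X e * z \<in> ?S (Suc n)"
    proof (rule additive_span_lmult, safe)
      fix c u p assume p: "(u, p) \<in> paths G" and n: "n = path_length (u, p)"
      have "X e * (scalar c * path_monomial (u, p)) = scalar c * (X e * path_monomial (u, p))"
        by (rule scalar_left_commute)
      also have "\<dots> \<approx> scalar c * (if u = head G e then path_monomial (tail G e, e # p) else 0)"
        by (rule eqv_lmult[OF X_path_monomial[OF e p]])
      finally have *: "X e * (scalar c * path_monomial (u, p))
        \<approx> scalar c * (if u = head G e then path_monomial (tail G e, e # p) else 0)" .
      have "scalar c * (if u = head G e then path_monomial (tail G e, e # p) else 0) \<in> ?S (Suc n)"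
      proof (cases "u = head G e")
        case True
        then have "(tail G e, e # p) \<in> paths G" using e p by (simp add: Cons_in_paths_iff)
        moreover have "path_length (tail G e, e # p) = Suc n" by (simp add: n path_length_def)
        ultimately show ?thesis using True by (intro additive_span_incl) (auto simp del: path_monomial_simps)
      qed (simp add: additive_span.base)
      then show "X e * (scalar c * path_monomial (u, p)) \<in> ?S (Suc (path_length (u, p)))"
        using additive_span_eqv[OF *] n by simp
    qed
  qed
qed

lemma edge_component_component_span: "edge_component n \<subseteq> component_span n"
proof (cases "n < 0")
  case True
  then show ?thesis by (auto simp: edge_component_def additive_span.base)
next
  case False
  have "additive_span {scalar c * path_monomial \<alpha> | c \<alpha>. \<alpha> \<in> paths G \<and> path_length \<alpha> = nat n} \<subseteq> component_span n"
  proof (rule additive_span_mono, safe)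
    fix c u p assume p: "(u, p) \<in> paths G" "path_length (u, p) = nat n"
    obtain v where v: "v \<in> verts G" "path_monomial (u, p) * V v \<approx> path_monomial (u, p)"
      using path_monomial_right_unit[OF p(1)] by blast
    \<comment> \<open>A ghost-free path alpha is of the form alpha beta* with beta the vertex at its
      right end.\<close>
    have "scalar c * path_monomial (u, p) \<approx> scalar c * (path_monomial (u, p) * ghost_monomial (v, []))"
      using eqv_lmult[OF eqv_sym[OF v(2)]] by simp
    moreover have "scalar c * (path_monomial (u, p) * ghost_monomial (v, [])) \<in> component_span n"
    proof (rule additive_span_incl, safe, intro exI conjI)
      show "int (path_length (u, p)) - int (path_length (v, [])) = n"
        using p False by (simp add: path_length_def)
    qed (use p v in \<open>simp_all add: Nil_in_paths_iff\<close>)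
    ultimately show "scalar c * path_monomial (u, p) \<in> component_span n" by (rule additive_span_eqv)
  qed
  then show ?thesis using edge_span_path_monomials[of "nat n"] False by (auto simp: edge_component_def)
qed

lemma filtration_component_span: "filtration m n \<subseteq> component_span n"
proof (induction m arbitrary: n)
  case 0
  then show ?case using edge_component_component_span by simp
next
  case (Suc m)
  have "ghost_span m n \<subseteq> component_span n"
  proof (rule additive_span_mono, safe)
    fix y e assume e: "e \<in> arcs G" and y: "y \<in> filtration m (n + 1)"
    have "y \<in> component_span (n + 1)" using y Suc by blast
    then show "y * Y e \<in> component_span n"
    proof (rule additive_span_rmult, safe)
      fix c u p v q
      assume p: "(u, p) \<in> paths G" and q: "(v, q) \<in> paths G"
        and n: "int (path_length (u, p)) - int (path_length (v, q)) = n + 1"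
      have "scalar c * (path_monomial (u, p) * ghost_monomial (v, q)) * Y e
          = scalar c * (path_monomial (u, p) * (ghost_monomial (v, q) * Y e))" by (simp only: mult.assoc)
      \<comment> \<open>Appending e* on the right of beta* gives the ghost of e beta: the star
        reverses the order, so e becomes the first edge.\<close>
      also have "\<dots> \<approx> scalar c * (path_monomial (u, p) * (if v = head G e then ghost_monomial (tail G e, e # q) else 0))"
        by (intro eqv_lmult ghost_monomial_Y e q)
      finally have *: "scalar c * (path_monomial (u, p) * ghost_monomial (v, q)) * Y e \<approx>
        scalar c * (path_monomial (u, p) * (if v = head G e then ghost_monomial (tail G e, e # q) else 0))" .
      show "scalar c * (path_monomial (u, p) * ghost_monomial (v, q)) * Y e \<in> component_span n"
      proof (rule additive_span_eqv[OF *], cases "v = head G e")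
        case True
        have "scalar c * (path_monomial (u, p) * ghost_monomial (tail G e, e # q)) \<in> component_span n"
        proof (rule additive_span_incl, rule CollectI, intro exI conjI)
          show "int (path_length (u, p)) - int (path_length (tail G e, e # q)) = n"
            using n by (simp add: path_length_def)
          show "(tail G e, e # q) \<in> paths G" using e q True by (simp add: Cons_in_paths_iff)
        qed (rule refl p)+
        then show "scalar c * (path_monomial (u, p) * (if v = head G e then ghost_monomial (tail G e, e # q) else 0)) \<in> component_span n"
          using True by simp
      qed (simp add: additive_span.base)
    qed
  qed
  then show ?case
    using edge_component_component_span[of n] by (auto intro: additive_span_add)
qed

theorem homogeneous_component_span:
  assumes "\<And>w. w \<in> Poly_Mapping.keys x \<Longrightarrow> letters w \<noteq> [] \<and> word_degree w = n"
  shows "x \<in> component_span n"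
  using homogeneous_filtration[OF assms] filtration_component_span by blast

end

section \<open>The grading of the free algebra\<close>

text \<open>Used with two predicates: a fixed word degree gives the homogeneous components, and a
  restriction on the letters gives the retraction onto the free algebra of the graph. Two such
  filters commute.\<close>

lift_definition filter_keys :: "('a \<Rightarrow> bool) \<Rightarrow> ('a \<Rightarrow>\<^sub>0 'b :: zero) \<Rightarrow> ('a \<Rightarrow>\<^sub>0 'b)"
  is "\<lambda>P f k. if P k then f k else 0"
  by (erule rev_finite_subset) auto

lemma lookup_filter_keys:
  "Poly_Mapping.lookup (filter_keys P x) k = (if P k then Poly_Mapping.lookup x k else 0)"
  by transfer simp

lemma keys_filter_keys: "Poly_Mapping.keys (filter_keys P x) = {k \<in> Poly_Mapping.keys x. P k}"
  by (auto simp: in_keys_iff lookup_filter_keys split: if_splits)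

lemma filter_keys_zero [simp]: "filter_keys P 0 = 0"
  by (rule poly_mapping_eqI) (simp add: lookup_filter_keys)

lemma filter_keys_add:
  "filter_keys P (x + y) = filter_keys P x + filter_keys P (y :: 'a \<Rightarrow>\<^sub>0 'b :: comm_monoid_add)"
  by (rule poly_mapping_eqI) (simp add: lookup_filter_keys lookup_add)

lemma filter_keys_diff:
  "filter_keys P (x - y) = filter_keys P x - filter_keys P (y :: 'a \<Rightarrow>\<^sub>0 'b :: ab_group_add)"
  by (rule poly_mapping_eqI) (simp add: lookup_filter_keys lookup_minus)

lemma filter_keys_sum:
  "filter_keys P (sum f S) = (\<Sum>i\<in>S. filter_keys P (f i :: 'a \<Rightarrow>\<^sub>0 'b :: comm_monoid_add))"
  by (induction S rule: infinite_finite_induct) (simp_all add: filter_keys_add)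

lemma filter_keys_single:
  "filter_keys P (Poly_Mapping.single k c) = (if P k then Poly_Mapping.single k c else 0)"
  by (rule poly_mapping_eqI) (simp add: lookup_filter_keys lookup_single when_def)

lemma filter_keys_filter_keys: "filter_keys P (filter_keys Q x) = filter_keys (\<lambda>k. P k \<and> Q k) x"
  by (rule poly_mapping_eqI) (simp add: lookup_filter_keys)

lemma filter_keys_eq_iff: "filter_keys P x = x \<longleftrightarrow> (\<forall>k\<in>Poly_Mapping.keys x. P k)"
  by (auto simp: poly_mapping_eq_iff fun_eq_iff lookup_filter_keys in_keys_iff)

abbreviation component :: "int \<Rightarrow> ('v, 'e, 'k :: field) free_alg \<Rightarrow> ('v, 'e, 'k) free_alg" where
  "component n \<equiv> filter_keys (\<lambda>w. word_degree w = n)"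

lemma word_degree_plus: "word_degree (u + w) = word_degree u + word_degree w"
  by (simp add: word_degree_def plus_free_word_def)

lemma word_degree_zero [simp]: "word_degree 0 = 0"
  by (simp add: word_degree_def zero_free_word_def)

lemma sum_component:
  "finite D \<Longrightarrow> (\<And>n. component n x \<noteq> 0 \<Longrightarrow> n \<in> D) \<Longrightarrow> (\<Sum>n\<in>D. component n x) = x"
proof (rule poly_mapping_eqI)
  fix w assume D: "finite D" "\<And>n. component n x \<noteq> 0 \<Longrightarrow> n \<in> D"
  have "Poly_Mapping.lookup (\<Sum>n\<in>D. component n x) w = (\<Sum>n\<in>D. if word_degree w = n then Poly_Mapping.lookup x w else 0)"
    by (simp add: lookup_sum lookup_filter_keys)
  also have "\<dots> = (if word_degree w \<in> D then Poly_Mapping.lookup x w else 0)" using D(1) by simp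
  also have "\<dots> = Poly_Mapping.lookup x w"
  proof -
    have "Poly_Mapping.lookup x w = 0" if "word_degree w \<notin> D"
    proof -
      have "component (word_degree w) x = 0" using D(2) that by blast
      then show ?thesis
        using lookup_filter_keys[of "\<lambda>u. word_degree u = word_degree w" x w] by simp
    qed
    then show ?thesis by simp
  qed
  finally show "Poly_Mapping.lookup (\<Sum>n\<in>D. component n x) w = Poly_Mapping.lookup x w" .
qed

lemma component_ne_0: "component n x \<noteq> 0 \<Longrightarrow> n \<in> word_degree ` Poly_Mapping.keys x"
  by (auto simp: poly_mapping_eq_iff fun_eq_iff lookup_filter_keys in_keys_iff split: if_splits)

lemma finite_component: "finite {n. component n x \<noteq> 0}"
  by (rule finite_subset[of _ "word_degree ` Poly_Mapping.keys x"]) (use component_ne_0 in auto)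

lemma component_component: "component m (component n x) = (if m = n then component n x else 0)"
  by (rule poly_mapping_eqI) (simp add: lookup_filter_keys)

lemma component_single_mult:
  "component n (Poly_Mapping.single w c * y) = Poly_Mapping.single w c * component (n - word_degree w) y"
  by (induction y rule: poly_mapping_single_induct)
    (auto simp: distrib_left filter_keys_add mult_single filter_keys_single word_degree_plus)

lemma component_homogeneous_mult:
  assumes "component i x = x"
  shows "component n (x * y) = x * component (n - i) y"
proof -
  have deg: "word_degree w = i" if "w \<in> Poly_Mapping.keys x" for w
    using assms that unfolding filter_keys_eq_iff by blast
  have "component n (x * y) = component n (\<Sum>w\<in>Poly_Mapping.keys x. Poly_Mapping.single w (Poly_Mapping.lookup x w) * y)"
    by (subst (1) poly_mapping_sum_keys[of x, symmetric]) (simp add: sum_distrib_right)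
  also have "\<dots> = (\<Sum>w\<in>Poly_Mapping.keys x. Poly_Mapping.single w (Poly_Mapping.lookup x w) * component (n - i) y)"
    unfolding filter_keys_sum by (intro sum.cong) (simp_all add: component_single_mult deg)
  also have "\<dots> = x * component (n - i) y"
    by (simp add: sum_distrib_right[symmetric] poly_mapping_sum_keys)
  finally show ?thesis .
qed

lemma component_mult:
  assumes "finite D" "\<And>i. component i x \<noteq> 0 \<Longrightarrow> i \<in> D"
  shows "component n (x * y) = (\<Sum>i\<in>D. component i x * component (n - i) y)"
proof -
  have "component n (x * y) = component n (\<Sum>i\<in>D. component i x * y)"
    by (subst (1) sum_component[OF assms, symmetric]) (simp_all add: sum_distrib_right)
  also have "\<dots> = (\<Sum>i\<in>D. component i x * component (n - i) y)"
    unfolding filter_keys_sum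
    by (intro sum.cong refl component_homogeneous_mult) (simp add: component_component)
  finally show ?thesis .
qed

section \<open>Homogeneity of the relations\<close>

definition homogeneous :: "int \<Rightarrow> ('v, 'e, 'k :: field) free_alg \<Rightarrow> bool" where
  "homogeneous n x \<longleftrightarrow> component n x = x"

lemma homogeneous_zero [simp]: "homogeneous n 0"
  by (simp add: homogeneous_def)

lemma homogeneous_gen: "homogeneous (letter_degree g) (gen g)"
  by (simp add: homogeneous_def gen_def filter_keys_single word_degree_def)

lemma homogeneous_vertex: "homogeneous 0 (vertex_gen v)"
  and homogeneous_edge: "homogeneous 1 (edge_gen e)"
  and homogeneous_ghost: "homogeneous (- 1) (ghost_gen e)"
  using homogeneous_gen[of "Vertex v"] homogeneous_gen[of "Edge e"] homogeneous_gen[of "Ghost e"] by simp_all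

lemma homogeneous_diff: "homogeneous n x \<Longrightarrow> homogeneous n y \<Longrightarrow> homogeneous n (x - y)"
  by (simp add: homogeneous_def filter_keys_diff)

lemma homogeneous_sum: "(\<And>i. i \<in> S \<Longrightarrow> homogeneous n (f i)) \<Longrightarrow> homogeneous n (sum f S)"
  by (simp add: homogeneous_def filter_keys_sum)

lemma homogeneous_mult: "homogeneous m x \<Longrightarrow> homogeneous n y \<Longrightarrow> m + n = k \<Longrightarrow> homogeneous k (x * y)"
  by (auto simp: homogeneous_def component_homogeneous_mult)

lemma homogeneous_if: "homogeneous n x \<Longrightarrow> homogeneous n (if b then x else 0)"
  by simp

lemma component_homogeneous: "homogeneous m x \<Longrightarrow> component n x = (if n = m then x else 0)"
  by (metis component_component homogeneous_def)

lemma leavitt_relation_homogeneous: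
  fixes E :: "('a, 'b) pre_digraph" and r :: "('a, 'b, 'k :: field) free_alg"
  assumes "r \<in> leavitt_relations E"
  shows "\<exists>n. homogeneous n r"
proof -
  note V = homogeneous_vertex and X = homogeneous_edge and Y = homogeneous_ghost and m = homogeneous_mult
  have "homogeneous 0 (vertex_gen v * vertex_gen w - (if v = w then vertex_gen v else 0) :: ('a, 'b, 'k) free_alg)" for v w
    by (intro homogeneous_diff homogeneous_if V m[OF V V]) simp
  moreover have "homogeneous 1 (vertex_gen v * edge_gen e - edge_gen e :: ('a, 'b, 'k) free_alg)" for v e
    by (intro homogeneous_diff X m[OF V X]) simp
  moreover have "homogeneous 1 (edge_gen e * vertex_gen v - edge_gen e :: ('a, 'b, 'k) free_alg)" for v e
    by (intro homogeneous_diff X m[OF X V]) simp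
  moreover have "homogeneous (- 1) (vertex_gen v * ghost_gen e - ghost_gen e :: ('a, 'b, 'k) free_alg)" for v e
    by (intro homogeneous_diff Y m[OF V Y]) simp
  moreover have "homogeneous (- 1) (ghost_gen e * vertex_gen v - ghost_gen e :: ('a, 'b, 'k) free_alg)" for v e
    by (intro homogeneous_diff Y m[OF Y V]) simp
  moreover have "homogeneous 0 (ghost_gen e * edge_gen f - (if e = f then vertex_gen v else 0) :: ('a, 'b, 'k) free_alg)" for v e f
    by (intro homogeneous_diff homogeneous_if V m[OF Y X]) simp
  moreover have "homogeneous 0 (vertex_gen v - (\<Sum>e\<in>out_arcs E v. edge_gen e * ghost_gen e) :: ('a, 'b, 'k) free_alg)" for v
    by (intro homogeneous_diff homogeneous_sum V m[OF X Y]) simp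
  ultimately show ?thesis using assms unfolding leavitt_relations_def by blast
qed

section \<open>The carrier of the free algebra and its ideals\<close>

abbreviation restrict_letters :: "('v, 'e) pre_digraph \<Rightarrow> ('v, 'e, 'k :: field) free_alg \<Rightarrow> ('v, 'e, 'k) free_alg" where
  "restrict_letters E \<equiv> filter_keys (\<lambda>w. set (letters w) \<subseteq> generators E)"

lemma carrier_free_algebra: "x \<in> carrier (free_algebra E) \<longleftrightarrow> restrict_letters E x = x"
  by (simp add: free_algebra_def filter_keys_eq_iff)

lemma restrict_letters_carrier: "restrict_letters E x \<in> carrier (free_algebra E)"
  by (simp add: carrier_free_algebra filter_keys_filter_keys)

text \<open>A concatenation avoids foreign letters exactly if both factors do, so dropping all words
  with foreign letters is a ring homomorphism.\<close>

lemma restrict_letters_mult: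
  "restrict_letters E (x * y) = restrict_letters E x * restrict_letters E y"
proof (induction x rule: poly_mapping_single_induct)
  case (single k c x)
  have "restrict_letters E (Poly_Mapping.single k c * y)
      = restrict_letters E (Poly_Mapping.single k c) * restrict_letters E y"
    by (induction y rule: poly_mapping_single_induct)
      (auto simp: distrib_left filter_keys_add mult_single filter_keys_single plus_free_word_def)
  then show ?case using single by (simp add: distrib_right filter_keys_add)
qed simp

lemma restrict_letters_one: "restrict_letters E 1 = 1"
  by (simp add: filter_keys_eq_iff zero_free_word_def)

lemma free_algebra_ring: "ring (free_algebra E :: ('a, 'b, 'c :: field) free_alg ring)"
proof (rule ringI)
  show "abelian_group (free_algebra E :: ('a, 'b, 'c) free_alg ring)"
  proof (rule abelian_groupI)
    fix x :: "('a, 'b, 'c) free_alg" assume "x \<in> carrier (free_algebra E)"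
    then have "- x \<in> carrier (free_algebra E)"
      by (simp add: free_algebra_def)
    then show "\<exists>y\<in>carrier (free_algebra E). y \<oplus>\<^bsub>free_algebra E\<^esub> x = \<zero>\<^bsub>free_algebra E\<^esub>"
      by (intro bexI[of _ "- x"]) (simp_all add: free_algebra_def)
  next
    fix x y :: "('a, 'b, 'c) free_alg"
    assume "x \<in> carrier (free_algebra E)" "y \<in> carrier (free_algebra E)"
    then have "x + y \<in> carrier (free_algebra E)" by (simp add: carrier_free_algebra filter_keys_add)
    then show "x \<oplus>\<^bsub>free_algebra E\<^esub> y \<in> carrier (free_algebra E)" by (simp add: free_algebra_def)
  qed (simp_all add: free_algebra_def algebra_simps)
  show "Group.monoid (free_algebra E :: ('a, 'b, 'c) free_alg ring)"
  proof (rule monoidI)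
    fix x y :: "('a, 'b, 'c) free_alg"
    assume "x \<in> carrier (free_algebra E)" "y \<in> carrier (free_algebra E)"
    then have "x * y \<in> carrier (free_algebra E)" by (simp add: carrier_free_algebra restrict_letters_mult)
    then show "x \<otimes>\<^bsub>free_algebra E\<^esub> y \<in> carrier (free_algebra E)" by (simp add: free_algebra_def)
  next
    have "(1 :: ('a, 'b, 'c) free_alg) \<in> carrier (free_algebra E)" by (simp only: carrier_free_algebra restrict_letters_one)
    then show "\<one>\<^bsub>free_algebra E\<^esub> \<in> carrier (free_algebra E :: ('a, 'b, 'c) free_alg ring)" by (simp add: free_algebra_def)
  qed (simp_all add: free_algebra_def mult.assoc)
qed (simp_all add: free_algebra_def algebra_simps)

lemma gen_in_carrier: "g \<in> generators E \<Longrightarrow> restrict_letters E (gen g) = gen g"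
  by (simp add: gen_def filter_keys_single)

lemma (in wf_digraph) leavitt_relations_carrier:
  "leavitt_relations G \<subseteq> carrier (free_algebra G)"
proof
  fix r :: "('a, 'b, 'k :: field) free_alg" assume r: "r \<in> leavitt_relations G"
  have V: "restrict_letters G (vertex_gen v) = vertex_gen v" if "v \<in> verts G" for v
    using that by (intro gen_in_carrier) (simp add: generators_def)
  have X: "restrict_letters G (edge_gen e) = edge_gen e" if "e \<in> arcs G" for e
    using that by (intro gen_in_carrier) (simp add: generators_def)
  have Y: "restrict_letters G (ghost_gen e) = ghost_gen e" if "e \<in> arcs G" for e
    using that by (intro gen_in_carrier) (simp add: generators_def)
  show "r \<in> carrier (free_algebra G)"
    using r unfolding leavitt_relations_def carrier_free_algebra
    by (elim UnE CollectE exE conjE)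
      (simp_all add: filter_keys_diff filter_keys_sum restrict_letters_mult V X Y regular_verts_def)
qed

lemma (in wf_digraph) leavitt_ideal_ideal: "ideal (leavitt_ideal G) (free_algebra G)"
  unfolding leavitt_ideal_def
  by (rule ring.genideal_ideal[OF free_algebra_ring leavitt_relations_carrier])

lemma (in wf_digraph) leavitt_relations_ideal: "leavitt_relations G \<subseteq> leavitt_ideal G"
  unfolding leavitt_ideal_def
  by (rule ring.genideal_self[OF free_algebra_ring leavitt_relations_carrier])

text \<open>Closure under negation follows from closure under multiplication, since -1 lies in the
  carrier.\<close>

lemma free_algebra_idealI:
  fixes T :: "('v, 'e, 'k :: field) free_alg set"
  assumes "T \<subseteq> carrier (free_algebra E)" "0 \<in> T"
    and "\<And>x y. x \<in> T \<Longrightarrow> y \<in> T \<Longrightarrow> x + y \<in> T"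
    and "\<And>x r. x \<in> T \<Longrightarrow> r \<in> carrier (free_algebra E) \<Longrightarrow> r * x \<in> T"
    and "\<And>x r. x \<in> T \<Longrightarrow> r \<in> carrier (free_algebra E) \<Longrightarrow> x * r \<in> T"
  shows "ideal T (free_algebra E)"
proof (rule idealI[OF free_algebra_ring])
  show "subgroup T (add_monoid (free_algebra E))"
  proof (rule group.subgroupI)
    show "group (add_monoid (free_algebra E :: ('v, 'e, 'k) free_alg ring))"
      by (rule abelian_group.a_group[OF ring.is_abelian_group[OF free_algebra_ring]])
    fix x assume x: "x \<in> T"
    have "- 1 \<in> carrier (free_algebra E :: ('v, 'e, 'k) free_alg ring)" by (simp add: free_algebra_def zero_free_word_def)
    then have mx: "- x \<in> T" using assms(4)[OF x, of "- 1"] by simp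
    have "inv\<^bsub>add_monoid (free_algebra E)\<^esub> x = - x"
      by (rule group.inv_equality[OF abelian_group.a_group[OF ring.is_abelian_group[OF free_algebra_ring]]])
        (use x mx assms(1) in \<open>auto simp: free_algebra_def\<close>)
    then show "inv\<^bsub>add_monoid (free_algebra E)\<^esub> x \<in> T" using mx by simp
  qed (use assms in \<open>auto simp: free_algebra_def\<close>)
qed (use assms in \<open>auto simp: free_algebra_def\<close>)

lemma (in wf_digraph) leavitt_ideal_minimal:
  "ideal T (free_algebra G) \<Longrightarrow> leavitt_relations G \<subseteq> T \<Longrightarrow> leavitt_ideal G \<subseteq> T"
  unfolding leavitt_ideal_def by (rule ring.genideal_minimal[OF free_algebra_ring])

context wf_digraph
begin

lemma leavitt_ideal_zero: "0 \<in> leavitt_ideal G"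
  using additive_subgroup.zero_closed[OF ideal.axioms(1)[OF leavitt_ideal_ideal]]
  by (simp add: free_algebra_def)

lemma leavitt_ideal_add: "x \<in> leavitt_ideal G \<Longrightarrow> y \<in> leavitt_ideal G \<Longrightarrow> x + y \<in> leavitt_ideal G"
  using additive_subgroup.a_closed[OF ideal.axioms(1)[OF leavitt_ideal_ideal]]
  by (simp add: free_algebra_def)

lemma leavitt_ideal_lmult:
  "x \<in> leavitt_ideal G \<Longrightarrow> r \<in> carrier (free_algebra G) \<Longrightarrow> r * x \<in> leavitt_ideal G"
  using ideal.I_l_closed[OF leavitt_ideal_ideal] by (simp add: free_algebra_def)

lemma leavitt_ideal_rmult:
  "x \<in> leavitt_ideal G \<Longrightarrow> r \<in> carrier (free_algebra G) \<Longrightarrow> x * r \<in> leavitt_ideal G"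
  using ideal.I_r_closed[OF leavitt_ideal_ideal] by (simp add: free_algebra_def)

lemma leavitt_ideal_sum:
  "(\<And>i. i \<in> S \<Longrightarrow> f i \<in> leavitt_ideal G) \<Longrightarrow> sum f S \<in> leavitt_ideal G"
  by (induction S rule: infinite_finite_induct) (auto intro: leavitt_ideal_add leavitt_ideal_zero)

lemma component_carrier: "x \<in> carrier (free_algebra G) \<Longrightarrow> component n x \<in> carrier (free_algebra G)"
  by (simp add: free_algebra_def keys_filter_keys)

text \<open>The elements all of whose components lie in the Leavitt ideal form an ideal themselves.
  It contains the relations because these are homogeneous, and minimality does the rest.\<close>

lemma component_leavitt_ideal:
  fixes x :: "('a, 'b, 'k :: field) free_alg"
  assumes "x \<in> leavitt_ideal G"
  shows "component n x \<in> leavitt_ideal G"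
proof -
  define T :: "('a, 'b, 'k) free_alg set"
    where "T = {x \<in> carrier (free_algebra G). \<forall>n. component n x \<in> leavitt_ideal G}"
  have mult: "component n (x * y) \<in> leavitt_ideal G"
    if "\<And>i j. component i x * component j y \<in> leavitt_ideal G" for n and x y :: "('a, 'b, 'k) free_alg"
    using that by (subst component_mult[OF finite_component[of x]]) (auto intro: leavitt_ideal_sum)
  have "ideal T (free_algebra G)"
  proof (rule free_algebra_idealI)
    fix x r :: "('a, 'b, 'k) free_alg" assume x: "x \<in> T" and r: "r \<in> carrier (free_algebra G)"
    then have "component n (r * x) \<in> leavitt_ideal G" "component n (x * r) \<in> leavitt_ideal G" for n
      using component_carrier[OF r]
      by (auto simp: T_def intro!: mult intro: leavitt_ideal_lmult leavitt_ideal_rmult)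
    moreover have "r * x \<in> carrier (free_algebra G)" "x * r \<in> carrier (free_algebra G)"
      using x r by (simp_all add: T_def carrier_free_algebra restrict_letters_mult)
    ultimately show "r * x \<in> T" "x * r \<in> T" by (simp_all add: T_def)
  qed (auto simp: T_def filter_keys_add leavitt_ideal_zero leavitt_ideal_add carrier_free_algebra)
  moreover have "leavitt_relations G \<subseteq> T"
  proof
    fix r :: "('a, 'b, 'k) free_alg" assume r: "r \<in> leavitt_relations G"
    obtain m where "homogeneous m r" using leavitt_relation_homogeneous[OF r] by blast
    then show "r \<in> T"
      using r leavitt_relations_ideal leavitt_relations_carrier leavitt_ideal_zero
      by (auto simp: T_def component_homogeneous)
  qed
  ultimately have "leavitt_ideal G \<subseteq> T" by (rule leavitt_ideal_minimal)
  then show ?thesis using assms by (auto simp: T_def)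
qed

end

text \<open>The empty word arises by concatenation only from two empty words, so the constant term
  is multiplicative.\<close>

lemma lookup_mult_0:
  "Poly_Mapping.lookup (x * y) 0 = Poly_Mapping.lookup x 0 * Poly_Mapping.lookup (y :: 'g free_word \<Rightarrow>\<^sub>0 'k :: field) 0"
proof (induction x rule: poly_mapping_single_induct)
  case (single w c x)
  have "Poly_Mapping.lookup (Poly_Mapping.single w c * y) 0
      = Poly_Mapping.lookup (Poly_Mapping.single w c) 0 * Poly_Mapping.lookup y 0"
    by (induction y rule: poly_mapping_single_induct)
      (auto simp: distrib_left lookup_add mult_single lookup_single when_def plus_free_word_def zero_free_word_def
        split: if_splits intro: free_word.expand)
  then show ?case using single by (simp add: distrib_right lookup_add)
qed simp

lemma letters_zero: "letters 0 = []"
  by (simp add: zero_free_word_def)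

section \<open>Vertices are nonzero\<close>

context countable_digraph
begin

text \<open>
  \<open>encode\<close> restricts to bijections $s^{-1}(v) \times \mathbb{N} \to \mathbb{N}$ for all $v$ that are not
  sinks, so $\{v\} \times \mathbb{N}$ is the disjoint union of copies of $\{r(e)\} \times \mathbb{N}$ over the
  edges $e$ leaving $v$.  Edges and ghost edges act along these partial bijections.
\<close>

definition encode :: "'b \<Rightarrow> nat \<Rightarrow> nat" where
  "encode e n = to_nat_on (out_arcs G (tail G e) \<times> UNIV) (e, n)"

definition decode :: "'a \<Rightarrow> nat \<Rightarrow> 'b \<times> nat" where
  "decode v = from_nat_into (out_arcs G v \<times> UNIV)"

lemma countable_out_arcs: "countable (out_arcs G v \<times> (UNIV :: nat set))"
  by (intro countable_SIGMA countable_subset[OF _ countable_arcs]) auto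

text \<open>\<open>to_nat_on\<close> enumerates a countable set onto all naturals only if the set is
  infinite; the factor N guarantees this even for finitely many edges.\<close>

lemma infinite_out_arcs_UNIV: "out_arcs G v \<noteq> {} \<Longrightarrow> infinite (out_arcs G v \<times> (UNIV :: nat set))"
  by (auto dest: finite_cartesian_productD2)

lemma decode_encode: "e \<in> arcs G \<Longrightarrow> decode (tail G e) (encode e n) = (e, n)"
  unfolding decode_def encode_def by (rule from_nat_into_to_nat_on[OF countable_out_arcs]) simp

lemma encode_decode:
  assumes "out_arcs G v \<noteq> {}"
  obtains e m where "decode v n = (e, m)" "e \<in> out_arcs G v" "encode e m = n"
proof -
  obtain e m where em: "decode v n = (e, m)" by fastforce
  have "decode v n \<in> out_arcs G v \<times> UNIV"
    unfolding decode_def using assms by (intro from_nat_into) auto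
  then have e: "e \<in> out_arcs G v" using em by simp
  then have "encode e m = to_nat_on (out_arcs G v \<times> UNIV) (decode v n)"
    by (simp add: encode_def em)
  then have "encode e m = n"
    unfolding decode_def by (simp add: countable_out_arcs infinite_out_arcs_UNIV[OF assms])
  then show thesis using that em e by blast
qed

text \<open>A vertex restricts a function to {v} x N. An edge e carries the part at r(e) to the copy
  belonging to e inside {s(e)} x N, and the ghost edge reads it back. Functions of arbitrary support
  are allowed, so no finiteness has to be preserved.\<close>

fun act_letter :: "('a, 'b) generator \<Rightarrow> ('a \<times> nat \<Rightarrow> 'k :: field) \<Rightarrow> 'a \<times> nat \<Rightarrow> 'k" where
  "act_letter (Vertex v) f (u, n) = (if u = v then f (u, n) else 0)"
| "act_letter (Edge e) f (u, n) =
     (if u = tail G e \<and> fst (decode u n) = e then f (head G e, snd (decode u n)) else 0)"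
| "act_letter (Ghost e) f (u, n) = (if u = head G e then f (tail G e, encode e n) else 0)"

definition act_word :: "('a, 'b) generator free_word \<Rightarrow> ('a \<times> nat \<Rightarrow> 'k :: field) \<Rightarrow> 'a \<times> nat \<Rightarrow> 'k" where
  "act_word w = foldr act_letter (letters w)"

lemma act_letter_linear:
  "act_letter g (\<lambda>p. c * f p + h p) = (\<lambda>p. c * act_letter g f p + act_letter g h p)"
proof
  fix p :: "'a \<times> nat"
  obtain u n where "p = (u, n)" by fastforce
  then show "act_letter g (\<lambda>p. c * f p + h p) p = c * act_letter g f p + act_letter g h p"
    by (cases g) auto
qed

lemma act_word_linear:
  "act_word w (\<lambda>p. c * f p + h p) = (\<lambda>p. c * act_word w f p + act_word w h p)"
proof -
  have "foldr act_letter ls (\<lambda>p. c * f p + h p) = (\<lambda>p. c * foldr act_letter ls f p + foldr act_letter ls h p)" for ls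
    by (induction ls) (simp_all add: act_letter_linear)
  then show ?thesis by (simp add: act_word_def)
qed

lemma act_word_zero: "act_word w (\<lambda>p. 0) = (\<lambda>p. 0)"
  using act_word_linear[of w 0 "\<lambda>p. 0" "\<lambda>p. 0"] act_word_linear[of w "- 1" "\<lambda>p. 0" "\<lambda>p. 0"]
  by (simp add: fun_eq_iff)

lemma act_word_plus: "act_word (v + w) f = act_word v (act_word w f)"
  by (simp add: act_word_def plus_free_word_def)

definition act :: "('a, 'b, 'k :: field) free_alg \<Rightarrow> ('a \<times> nat \<Rightarrow> 'k) \<Rightarrow> 'a \<times> nat \<Rightarrow> 'k" where
  "act x f p = (\<Sum>w\<in>Poly_Mapping.keys x. Poly_Mapping.lookup x w * act_word w f p)"

lemma act_zero [simp]: "act 0 f p = 0"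
  by (simp add: act_def)

lemma act_add: "act (x + y) f p = act x f p + act y f p"
  unfolding act_def by (rule setsum_keys_plus_distrib) (simp_all add: distrib_right)

lemma act_diff: "act (x - y) f p = act x f p - act y f p"
  using act_add[of "x - y" y f p] by simp

lemma act_sum: "act (sum x S) f p = (\<Sum>i\<in>S. act (x i) f p)"
  by (induction S rule: infinite_finite_induct) (simp_all add: act_add)

lemma act_single: "act (Poly_Mapping.single w c) f p = c * act_word w f p"
  by (simp add: act_def)

lemma act_gen: "act (gen g) f = act_letter g f"
  by (rule ext) (simp add: gen_def act_single act_word_def)

lemma act_mult: "act (x * y) f = act x (act y f)"
proof (rule ext)
  fix p
  show "act (x * y) f p = act x (act y f) p"
  proof (induction x rule: poly_mapping_single_induct)
    case (single w c x)
    have "act (Poly_Mapping.single w c * y) f p = c * act_word w (act y f) p"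
    proof (induction y rule: poly_mapping_single_induct)
      case zero
      have "act 0 f = (\<lambda>p. 0)" by (rule ext) simp
      then show ?case by (simp add: act_word_zero)
    next
      case (single v d y)
      have "act (Poly_Mapping.single v d + y) f = (\<lambda>p. d * act_word v f p + act y f p)"
        by (rule ext) (simp add: act_add act_single)
      then show ?case
        using single by (simp add: distrib_left act_add mult_single act_single act_word_plus act_word_linear mult.assoc)
    qed
    then show ?case using single by (simp add: distrib_right act_add act_single)
  qed simp
qed

lemma act_leavitt_relation:
  assumes "r \<in> leavitt_relations G"
  shows "act r f p = 0"
proof -
  obtain u n where p: "p = (u, n)" by fastforce
  \<comment> \<open>At the point (v, n) only the edge encoded in n contributes to the sum of
    relation (4), and for it encoding undoes decoding.\<close>
  have vertex: "act (vertex_gen v) f (v, n) = (\<Sum>e\<in>out_arcs G v. act (edge_gen e) (act (ghost_gen e) f) (v, n))"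
    if "v \<in> regular_verts G" for v
  proof -
    have v: "out_arcs G v \<noteq> {}" "finite (out_arcs G v)" using that by (auto simp: regular_verts_def)
    obtain e m where e: "decode v n = (e, m)" "e \<in> out_arcs G v" "encode e m = n"
      using encode_decode[OF v(1)] .
    have "act (edge_gen e') (act (ghost_gen e') f) (v, n) = (if e' = e then f (v, n) else 0)"
      if "e' \<in> out_arcs G v" for e'
      using that e by (auto simp: act_gen)
    then show ?thesis using v(2) e(2) by (simp add: act_gen)
  qed
  show ?thesis
    using assms unfolding leavitt_relations_def Un_iff mem_Collect_eq p
  proof (elim disjE exE conjE)
    fix v assume r: "r = vertex_gen v - (\<Sum>e\<in>out_arcs G v. edge_gen e * ghost_gen e)"
      and v: "v \<in> regular_verts G"
    show "act r f (u, n) = 0"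
    proof (cases "u = v")
      case True
      then show ?thesis using vertex[OF v] by (simp add: r act_diff act_sum act_mult)
    next
      case False
      then show ?thesis by (auto simp: r act_diff act_sum act_mult act_gen intro: sum.neutral)
    qed
  qed (auto simp: act_diff act_mult act_gen decode_encode)
qed

text \<open>The elements acting as zero form an ideal that contains the relations; minimality of the
  Leavitt ideal applies again.\<close>

lemma act_leavitt_ideal:
  fixes x :: "('a, 'b, 'k :: field) free_alg"
  assumes "x \<in> leavitt_ideal G"
  shows "act x f p = 0"
proof -
  define T :: "('a, 'b, 'k) free_alg set"
    where "T = {x \<in> carrier (free_algebra G). \<forall>f p. act x f p = 0}"
  have "ideal T (free_algebra G)"
  proof (rule free_algebra_idealI)
    fix x r :: "('a, 'b, 'k) free_alg" assume x: "x \<in> T" and r: "r \<in> carrier (free_algebra G)"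
    have "act x f = (\<lambda>p. 0)" for f using x by (auto simp: T_def)
    moreover have "act r (\<lambda>p. 0) p = 0" for p by (simp add: act_def act_word_zero)
    moreover have "r * x \<in> carrier (free_algebra G)" "x * r \<in> carrier (free_algebra G)"
      using x r by (simp_all add: T_def carrier_free_algebra restrict_letters_mult)
    ultimately show "r * x \<in> T" "x * r \<in> T" by (simp_all add: T_def act_mult)
  qed (auto simp: T_def act_add carrier_free_algebra filter_keys_add)
  moreover have "leavitt_relations G \<subseteq> T"
    using leavitt_relations_carrier act_leavitt_relation by (auto simp: T_def)
  ultimately have "leavitt_ideal G \<subseteq> T" by (rule leavitt_ideal_minimal)
  then show ?thesis using assms unfolding T_def by blast
qed

lemma vertex_notin_leavitt_ideal: "vertex_gen v \<notin> leavitt_ideal G"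
  \<comment> \<open>On the constant function 1 the vertex v has the value 1 at (v, 0).\<close>
  using act_leavitt_ideal[of "vertex_gen v" "\<lambda>p. 1" "(v, 0)"] by (auto simp: act_gen)

text \<open>
  The ideal generated by the Leavitt relations and the letters outside the graph.
\<close>

definition extended_ideal :: "('a, 'b, 'k :: field) free_alg set" where
  "extended_ideal = {x. restrict_letters G x \<in> leavitt_ideal G}"

lemma extended_ideal_iff:
  "x \<in> carrier (free_algebra G) \<Longrightarrow> x \<in> extended_ideal \<longleftrightarrow> x \<in> leavitt_ideal G"
  by (simp add: extended_ideal_def carrier_free_algebra)

text \<open>\<open>extended_ideal\<close> is the preimage of the Leavitt ideal under the ring
  homomorphism \<open>restrict_letters\<close>.\<close>

lemma type_ideal_extended_ideal: "type_ideal extended_ideal"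
  by unfold_locales
    (auto simp: extended_ideal_def filter_keys_add restrict_letters_mult
      intro: leavitt_ideal_zero leavitt_ideal_add leavitt_ideal_lmult leavitt_ideal_rmult restrict_letters_carrier)

lemma leavitt_quotient_extended_ideal:
  "leavitt_quotient G (extended_ideal :: ('a, 'b, 'k :: field) free_alg set)"
proof (intro leavitt_quotient.intro type_ideal_extended_ideal leavitt_quotient_axioms.intro)
  show "leavitt_relations G \<subseteq> (extended_ideal :: ('a, 'b, 'k) free_alg set)"
    using leavitt_relations_carrier leavitt_relations_ideal extended_ideal_iff by blast
  show "gen g \<in> (extended_ideal :: ('a, 'b, 'k) free_alg set)" if "g \<notin> generators G" for g
    using that leavitt_ideal_zero by (simp add: extended_ideal_def gen_def filter_keys_single)
  show "vertex_gen v \<notin> (extended_ideal :: ('a, 'b, 'k) free_alg set)" if "v \<in> verts G" for v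
  proof -
    have "restrict_letters G (vertex_gen v :: ('a, 'b, 'k) free_alg) = vertex_gen v"
      using that by (intro gen_in_carrier) (simp add: generators_def)
    then show ?thesis using vertex_notin_leavitt_ideal by (simp add: extended_ideal_def)
  qed
qed (rule wf_digraph_axioms)

lemma graded_extended_ideal:
  "graded_ring_ideal (extended_ideal :: ('a, 'b, 'k :: field) free_alg set) component {x. Poly_Mapping.lookup x 0 = 0}"
proof -
  interpret leavitt_quotient G "extended_ideal :: ('a, 'b, 'k) free_alg set"
    by (rule leavitt_quotient_extended_ideal)
  show ?thesis
  proof (intro graded_ring_ideal.intro type_ideal_extended_ideal graded_ring_ideal_axioms.intro)
    fix x n assume "x \<in> {x :: ('a, 'b, 'k) free_alg. Poly_Mapping.lookup x 0 = 0}" "component n x = x"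
      "\<And>r. x * r * x \<in> extended_ideal"
    moreover have "letters w \<noteq> []" if "w \<in> Poly_Mapping.keys x" "Poly_Mapping.lookup x 0 = 0" for w
      using that by (cases w) (auto simp: in_keys_iff zero_free_word_def)
    ultimately show "x \<in> extended_ideal"
      by (intro null_homogeneous_mem[of x n]) (auto simp: null_def filter_keys_eq_iff)
  next
    fix x :: "('a, 'b, 'k) free_alg" and n assume "x \<in> extended_ideal"
    then have "component n (restrict_letters G x) \<in> leavitt_ideal G"
      by (intro component_leavitt_ideal) (simp add: extended_ideal_def)
    \<comment> \<open>Taking a component commutes with restricting the letters, so gradedness passes
      from the Leavitt ideal to its preimage.\<close>
    then show "component n x \<in> extended_ideal"
      by (simp add: extended_ideal_def filter_keys_filter_keys conj_commute)
  qed (auto simp: filter_keys_add finite_component component_component lookup_mult_0 lookup_minus lookup_filter_keys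
      intro!: sum_component component_mult)
qed

section \<open>Passing to cosets\<close>

definition nonunital :: "('a, 'b, 'k :: field) free_alg set" where
  "nonunital = {x \<in> carrier (free_algebra G). Poly_Mapping.lookup x 0 = 0}"

definition homogeneous_part :: "int \<Rightarrow> ('a, 'b, 'k :: field) free_alg set" where
  "homogeneous_part n = {x \<in> nonunital. homogeneous n x}"

lemma carrier_closed:
  "x \<in> carrier (free_algebra G) \<Longrightarrow> y \<in> carrier (free_algebra G) \<Longrightarrow> x + y \<in> carrier (free_algebra G)"
  "x \<in> carrier (free_algebra G) \<Longrightarrow> y \<in> carrier (free_algebra G) \<Longrightarrow> x - y \<in> carrier (free_algebra G)"
  "x \<in> carrier (free_algebra G) \<Longrightarrow> y \<in> carrier (free_algebra G) \<Longrightarrow> x * y \<in> carrier (free_algebra G)"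
  "0 \<in> carrier (free_algebra G)"
  "scalar c \<in> carrier (free_algebra G)"
  by (simp_all add: carrier_free_algebra filter_keys_add filter_keys_diff restrict_letters_mult
      filter_keys_single zero_free_word_def)

lemma nonunital_carrier: "x \<in> nonunital \<Longrightarrow> x \<in> carrier (free_algebra G)"
  by (simp add: nonunital_def)

lemma nonunital_zero: "0 \<in> nonunital"
  by (simp add: nonunital_def carrier_closed)

lemma nonunital_add: "x \<in> nonunital \<Longrightarrow> y \<in> nonunital \<Longrightarrow> x + y \<in> nonunital"
  by (simp add: nonunital_def carrier_closed lookup_add)

lemma nonunital_sum: "(\<And>i. i \<in> S \<Longrightarrow> f i \<in> nonunital) \<Longrightarrow> sum f S \<in> nonunital"
  by (induction S rule: infinite_finite_induct) (simp_all add: nonunital_zero nonunital_add)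

lemma nonunital_lmult: "x \<in> nonunital \<Longrightarrow> r \<in> carrier (free_algebra G) \<Longrightarrow> r * x \<in> nonunital"
  by (simp add: nonunital_def carrier_closed lookup_mult_0)

lemma nonunital_rmult: "x \<in> nonunital \<Longrightarrow> r \<in> carrier (free_algebra G) \<Longrightarrow> x * r \<in> nonunital"
  by (simp add: nonunital_def carrier_closed lookup_mult_0)

lemma nonunital_mult: "x \<in> nonunital \<Longrightarrow> y \<in> nonunital \<Longrightarrow> x * y \<in> nonunital"
  by (simp add: nonunital_lmult nonunital_carrier)

lemma nonunital_component: "x \<in> nonunital \<Longrightarrow> component n x \<in> nonunital"
  by (simp add: nonunital_def component_carrier lookup_filter_keys)

lemma gen_nonunital: "g \<in> generators G \<Longrightarrow> gen g \<in> nonunital"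
  by (simp add: nonunital_def carrier_free_algebra gen_in_carrier)
    (simp add: gen_def lookup_single zero_free_word_def)

lemma prod_list_gen_carrier:
  "set gs \<subseteq> generators G \<Longrightarrow> prod_list (map gen gs) \<in> carrier (free_algebra G)"
  by (induction gs) (simp_all add: carrier_free_algebra restrict_letters_one restrict_letters_mult gen_in_carrier)

lemma homogeneous_prod_list_gen: "homogeneous (\<Sum>g\<leftarrow>gs. letter_degree g) (prod_list (map gen gs))"
proof (induction gs)
  case Nil
  show ?case by (simp add: homogeneous_def filter_keys_eq_iff)
next
  case (Cons g gs)
  then show ?case by (simp add: homogeneous_mult[OF homogeneous_gen])
qed

lemma path_monomial_homogeneous_part:
  assumes "\<alpha> \<in> paths G"
  shows "(path_monomial \<alpha> :: ('a, 'b, 'k :: field) free_alg) \<in> homogeneous_part (path_length \<alpha>)"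
proof -
  obtain u p where \<alpha>: "\<alpha> = (u, p)" by fastforce
  show ?thesis
  proof (cases p)
    case Nil
    then have "Vertex u \<in> generators G" using assms by (auto simp: \<alpha> paths_def awalk_Nil_iff generators_def)
    then show ?thesis
      by (simp add: \<alpha> Nil homogeneous_part_def path_length_def gen_nonunital homogeneous_vertex)
  next
    case (Cons e q)
    have arcs: "set p \<subseteq> arcs G" using assms by (auto simp: \<alpha> paths_def awalk_def)
    then have "set (map Edge q) \<subseteq> generators G" "Edge e \<in> generators G" by (auto simp: generators_def Cons)
    then have "(gen (Edge e) * prod_list (map gen (map Edge q)) :: ('a, 'b, 'k) free_alg) \<in> nonunital"
      by (intro nonunital_rmult prod_list_gen_carrier gen_nonunital)
    moreover have "homogeneous (int (length p)) (prod_list (map gen (map Edge p)) :: ('a, 'b, 'k) free_alg)"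
      using homogeneous_prod_list_gen[of "map Edge p"] by (simp add: comp_def sum_list_triv)
    ultimately show ?thesis
      by (simp add: \<alpha> Cons homogeneous_part_def path_length_def comp_def)
  qed
qed

lemma ghost_monomial_homogeneous_part:
  assumes "\<alpha> \<in> paths G"
  shows "(ghost_monomial \<alpha> :: ('a, 'b, 'k :: field) free_alg) \<in> homogeneous_part (- int (path_length \<alpha>))"
proof -
  obtain u p where \<alpha>: "\<alpha> = (u, p)" by fastforce
  show ?thesis
  proof (cases p)
    case Nil
    then have "Vertex u \<in> generators G" using assms by (auto simp: \<alpha> paths_def awalk_Nil_iff generators_def)
    then show ?thesis
      by (simp add: \<alpha> Nil homogeneous_part_def path_length_def gen_nonunital homogeneous_vertex)
  next
    case (Cons e q)
    have arcs: "set p \<subseteq> arcs G" using assms by (auto simp: \<alpha> paths_def awalk_def)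
    then have "set (map Ghost (rev q)) \<subseteq> generators G" "Ghost e \<in> generators G" by (auto simp: generators_def Cons)
    then have "(prod_list (map gen (map Ghost (rev q))) * gen (Ghost e) :: ('a, 'b, 'k) free_alg) \<in> nonunital"
      by (intro nonunital_lmult prod_list_gen_carrier gen_nonunital)
    moreover have "homogeneous (- int (length p)) (prod_list (map gen (map Ghost (rev p))) :: ('a, 'b, 'k) free_alg)"
      using homogeneous_prod_list_gen[of "map Ghost (rev p)"] by (simp add: comp_def sum_list_triv)
    ultimately show ?thesis
      by (simp add: \<alpha> Cons homogeneous_part_def path_length_def comp_def)
  qed
qed

lemma leavitt_ideal_uminus:
  fixes x :: "('a, 'b, 'k :: field) free_alg"
  assumes "x \<in> leavitt_ideal G"
  shows "- x \<in> leavitt_ideal G"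
proof -
  have "scalar (- 1) * x \<in> leavitt_ideal G"
    by (rule leavitt_ideal_lmult[OF assms carrier_closed(5)])
  then show ?thesis by (simp add: single_uminus)
qed

lemma leavitt_ideal_diff: "x \<in> leavitt_ideal G \<Longrightarrow> y \<in> leavitt_ideal G \<Longrightarrow> x - y \<in> leavitt_ideal G"
  using leavitt_ideal_add[of x "- y"] leavitt_ideal_uminus[of y] by simp

section \<open>The operations on cosets, computed on representatives\<close>

lemma lpa_class_image: "lpa_class G x = (\<lambda>h. h + x) ` leavitt_ideal G"
  unfolding lpa_class_def a_r_coset_def' by (auto simp: free_algebra_def)

lemma lpa_class_eq_iff: "lpa_class G x = lpa_class G y \<longleftrightarrow> x - y \<in> leavitt_ideal G"
proof
  assume "lpa_class G x = lpa_class G y"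
  moreover have "x \<in> lpa_class G x"
    unfolding lpa_class_image using leavitt_ideal_zero by (intro image_eqI[of _ _ 0]) auto
  ultimately have "x \<in> (\<lambda>h. h + y) ` leavitt_ideal G" by (simp add: lpa_class_image)
  then show "x - y \<in> leavitt_ideal G" by auto
next
  assume *: "x - y \<in> leavitt_ideal G"
  have "h + x \<in> (\<lambda>h. h + y) ` leavitt_ideal G" if "h \<in> leavitt_ideal G" for h
    using leavitt_ideal_add[OF that *] by (intro image_eqI[of _ _ "h + (x - y)"]) auto
  moreover have "h + y \<in> (\<lambda>h. h + x) ` leavitt_ideal G" if "h \<in> leavitt_ideal G" for h
    using leavitt_ideal_diff[OF that *] by (intro image_eqI[of _ _ "h - (x - y)"]) auto
  ultimately show "lpa_class G x = lpa_class G y" unfolding lpa_class_image by blast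
qed

abbreviation LPA :: "('k :: field, ('a, 'b, 'k) lpa) module" where
  "LPA \<equiv> leavitt_path_algebra G"

lemma lpa_carrier: "carrier LPA = lpa_class G ` nonunital"
  by (simp add: leavitt_path_algebra_def nonunital_def)

lemma lpa_zero: "\<zero>\<^bsub>LPA\<^esub> = lpa_class G 0"
  by (simp add: leavitt_path_algebra_def lpa_class_image)

lemma lpa_class_eq_zero_iff: "lpa_class G x = \<zero>\<^bsub>LPA\<^esub> \<longleftrightarrow> x \<in> leavitt_ideal G"
  by (simp add: lpa_zero lpa_class_eq_iff)

lemma lpa_mult:
  assumes "x \<in> carrier (free_algebra G)" "y \<in> carrier (free_algebra G)"
  shows "lpa_class G x \<otimes>\<^bsub>LPA\<^esub> lpa_class G y = lpa_class G (x * y)"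
  using ideal.rcoset_mult_add[OF leavitt_ideal_ideal assms]
  by (simp add: leavitt_path_algebra_def lpa_class_def) (simp add: free_algebra_def)

lemma lpa_add:
  assumes "x \<in> carrier (free_algebra G)" "y \<in> carrier (free_algebra G)"
  shows "lpa_class G x \<oplus>\<^bsub>LPA\<^esub> lpa_class G y = lpa_class G (x + y)"
proof -
  interpret I: ideal "leavitt_ideal G" "free_algebra G" by (rule leavitt_ideal_ideal)
  show ?thesis
    using I.a_rcos_sum[OF assms]
    by (simp add: leavitt_path_algebra_def lpa_class_def) (simp add: free_algebra_def)
qed

text \<open>The union in the definition of scalar multiplication runs over equal cosets, since the
  Leavitt ideal is closed under scalars.\<close>

lemma lpa_smult:
  assumes "x \<in> carrier (free_algebra G)"
  shows "c \<odot>\<^bsub>LPA\<^esub> lpa_class G x = lpa_class G (scalar c * x)"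
proof -
  have "lpa_class G (scale c y) = lpa_class G (scalar c * x)" if y: "y \<in> lpa_class G x" for y
  proof -
    have "y - x \<in> leavitt_ideal G" using y by (auto simp: lpa_class_image)
    then have "scalar c * (y - x) \<in> leavitt_ideal G" by (intro leavitt_ideal_lmult carrier_closed)
    then show ?thesis by (simp add: lpa_class_eq_iff scale_def right_diff_distrib)
  qed
  moreover have "lpa_class G x \<noteq> {}" using leavitt_ideal_zero by (auto simp: lpa_class_image)
  ultimately show ?thesis by (simp add: leavitt_path_algebra_def)
qed

lemma lpa_abelian_monoid: "abelian_monoid (LPA :: ('k :: field, ('a, 'b, 'k) lpa) module)"
proof (rule abelian_monoidI)
  fix x y z :: "('a, 'b, 'k) lpa"
  assume "x \<in> carrier LPA" "y \<in> carrier LPA" "z \<in> carrier LPA"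
  then obtain a b c where "x = lpa_class G a" "y = lpa_class G b" "z = lpa_class G c"
    "a \<in> nonunital" "b \<in> nonunital" "c \<in> nonunital"
    by (auto simp: lpa_carrier)
  then show "x \<oplus>\<^bsub>LPA\<^esub> y \<oplus>\<^bsub>LPA\<^esub> z = x \<oplus>\<^bsub>LPA\<^esub> (y \<oplus>\<^bsub>LPA\<^esub> z)"
    by (simp add: lpa_add nonunital_carrier nonunital_add add.assoc)
qed (auto simp: lpa_carrier lpa_add lpa_zero nonunital_carrier nonunital_add nonunital_zero add.commute)

lemma lpa_finsum:
  assumes "finite S" "\<And>i. i \<in> S \<Longrightarrow> x i = lpa_class G (h i)" "\<And>i. i \<in> S \<Longrightarrow> h i \<in> nonunital"
  shows "finsum LPA x S = lpa_class G (sum h S)"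
proof -
  interpret abelian_monoid "LPA :: ('k :: field, ('a, 'b, 'k) lpa) module" by (rule lpa_abelian_monoid)
  show ?thesis
    using assms
  proof (induction S rule: finite_induct)
    case empty
    show ?case by (simp add: lpa_zero)
  next
    case (insert i S)
    have "finsum LPA x (insert i S) = x i \<oplus>\<^bsub>LPA\<^esub> finsum LPA x S"
      using insert by (intro finsum_insert) (auto simp: lpa_carrier)
    also have "\<dots> = lpa_class G (h i) \<oplus>\<^bsub>LPA\<^esub> lpa_class G (sum h S)" using insert by simp
    also have "\<dots> = lpa_class G (h i + sum h S)" using insert by (intro lpa_add nonunital_carrier nonunital_sum) auto
    finally show ?case using insert by simp
  qed
qed

lemma lpa_component_generator:
  assumes "\<alpha> \<in> paths G" "\<beta> \<in> paths G"
  shows "c \<odot>\<^bsub>LPA\<^esub> (lpa_path G \<alpha> \<otimes>\<^bsub>LPA\<^esub> lpa_ghost_path G \<beta>)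
    = lpa_class G (scalar (c :: 'k :: field) * (path_monomial \<alpha> * ghost_monomial \<beta>))"
proof -
  have "(path_monomial \<alpha> :: ('a, 'b, 'k) free_alg) \<in> carrier (free_algebra G)"
    "(ghost_monomial \<beta> :: ('a, 'b, 'k) free_alg) \<in> carrier (free_algebra G)"
    using path_monomial_homogeneous_part[OF assms(1), where 'k = 'k]
      ghost_monomial_homogeneous_part[OF assms(2), where 'k = 'k]
    by (simp_all add: homogeneous_part_def nonunital_carrier)
  then show ?thesis
    by (simp add: lpa_path_def lpa_ghost_path_def path_monomial_def[symmetric] ghost_monomial_def[symmetric]
        lpa_mult lpa_smult carrier_closed)
qed

lemma homogeneous_part_generator:
  assumes "\<alpha> \<in> paths G" "\<beta> \<in> paths G" "int (path_length \<alpha>) - int (path_length \<beta>) = n"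
  shows "scalar (c :: 'k :: field) * (path_monomial \<alpha> * ghost_monomial \<beta>) \<in> homogeneous_part n"
proof -
  have c: "homogeneous 0 (scalar c :: ('a, 'b, 'k) free_alg)"
    by (simp add: homogeneous_def filter_keys_single)
  have p: "(path_monomial \<alpha> :: ('a, 'b, 'k) free_alg) \<in> nonunital"
      "homogeneous (path_length \<alpha>) (path_monomial \<alpha> :: ('a, 'b, 'k) free_alg)"
    and g: "(ghost_monomial \<beta> :: ('a, 'b, 'k) free_alg) \<in> nonunital"
      "homogeneous (- int (path_length \<beta>)) (ghost_monomial \<beta> :: ('a, 'b, 'k) free_alg)"
    using path_monomial_homogeneous_part[OF assms(1), where 'k = 'k]
      ghost_monomial_homogeneous_part[OF assms(2), where 'k = 'k]
    by (simp_all add: homogeneous_part_def)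
  have "homogeneous n (scalar c * (path_monomial \<alpha> * ghost_monomial \<beta>))"
    by (rule homogeneous_mult[OF c homogeneous_mult[OF p(2) g(2) refl]]) (use assms(3) in simp)
  moreover have "scalar c * (path_monomial \<alpha> * ghost_monomial \<beta>) \<in> nonunital"
    by (intro nonunital_lmult nonunital_mult p g carrier_closed(5))
  ultimately show ?thesis by (simp add: homogeneous_part_def)
qed

lemma homogeneous_part_add:
  "x \<in> homogeneous_part n \<Longrightarrow> y \<in> homogeneous_part n \<Longrightarrow> x + y \<in> homogeneous_part n"
  by (simp add: homogeneous_part_def nonunital_add homogeneous_def filter_keys_add)

text \<open>The span of the classes alpha beta* is described by honest homogeneous representatives.
  This allows components in L to be computed by filtering words.\<close>

lemma lpa_component_eq:
  "(lpa_component G n :: ('a, 'b, 'k :: field) lpa set) = lpa_class G ` homogeneous_part n"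
proof (intro equalityI subsetI)
  fix X :: "('a, 'b, 'k) lpa" assume "X \<in> lpa_component G n"
  then show "X \<in> lpa_class G ` homogeneous_part n"
    unfolding lpa_component_def
  proof (induction rule: lin_span.induct)
    case zero
    show ?case by (auto simp: lpa_zero homogeneous_part_def nonunital_zero)
  next
    case (add_smult X Z c)
    obtain z where z: "Z = lpa_class G z" "z \<in> homogeneous_part n" using add_smult.IH by blast
    obtain \<alpha> \<beta> where X: "X = lpa_path G \<alpha> \<otimes>\<^bsub>LPA\<^esub> lpa_ghost_path G \<beta>"
      and p: "\<alpha> \<in> paths G" "\<beta> \<in> paths G" "int (path_length \<alpha>) - int (path_length \<beta>) = n"
      using add_smult.hyps(1) by blast
    define y :: "('a, 'b, 'k) free_alg" where "y = scalar c * (path_monomial \<alpha> * ghost_monomial \<beta>)"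
    have y: "y \<in> homogeneous_part n" unfolding y_def by (rule homogeneous_part_generator[OF p])
    have "c \<odot>\<^bsub>LPA\<^esub> X \<oplus>\<^bsub>LPA\<^esub> Z = lpa_class G (y + z)"
      unfolding X lpa_component_generator[OF p(1,2)] y_def[symmetric] z(1)
      using y z(2) by (intro lpa_add) (auto simp: homogeneous_part_def nonunital_carrier)
    then show ?case using homogeneous_part_add[OF y z(2)] by blast
  qed
next
  interpret leavitt_quotient G "extended_ideal :: ('a, 'b, 'k) free_alg set"
    by (rule leavitt_quotient_extended_ideal)
  fix X :: "('a, 'b, 'k) lpa" assume "X \<in> lpa_class G ` homogeneous_part n"
  then obtain x where X: "X = lpa_class G x" and x: "x \<in> homogeneous_part n" by blast
  have "letters w \<noteq> [] \<and> word_degree w = n" if "w \<in> Poly_Mapping.keys x" for w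
    using x that by (cases w)
      (auto simp: homogeneous_part_def nonunital_def homogeneous_def filter_keys_eq_iff in_keys_iff zero_free_word_def)
  then have "x \<in> component_span n" by (rule homogeneous_component_span)
  \<comment> \<open>\<open>component_span\<close> lives in the free algebra on all letters of the
    type, so partial sums may leave the carrier by elements of \<open>extended_ideal\<close>.
    Applying \<open>restrict_letters\<close> makes the claim meaningful for them.\<close>
  then have "lpa_class G (restrict_letters G x) \<in> lpa_component G n"
  proof induction
    case (base x)
    then have "lpa_class G (restrict_letters G x) = \<zero>\<^bsub>LPA\<^esub>"
      by (simp add: lpa_class_eq_zero_iff extended_ideal_def)
    then show ?case unfolding lpa_component_def by (simp add: lin_span.zero)
  next
    case (step y z)
    obtain c \<alpha> \<beta> where y: "y = scalar c * (path_monomial \<alpha> * ghost_monomial \<beta>)"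
      and p: "\<alpha> \<in> paths G" "\<beta> \<in> paths G" "int (path_length \<alpha>) - int (path_length \<beta>) = n"
      using step.hyps(1) by blast
    have yc: "y \<in> carrier (free_algebra G)"
      using homogeneous_part_generator[OF p, of c] by (simp add: y homogeneous_part_def nonunital_carrier)
    have "lpa_class G (restrict_letters G (y + z)) = lpa_class G (y + restrict_letters G z)"
      using yc by (simp add: filter_keys_add carrier_free_algebra)
    also have "\<dots> = lpa_class G y \<oplus>\<^bsub>LPA\<^esub> lpa_class G (restrict_letters G z)"
      by (rule lpa_add[OF yc restrict_letters_carrier, symmetric])
    also have "lpa_class G y = c \<odot>\<^bsub>LPA\<^esub> (lpa_path G \<alpha> \<otimes>\<^bsub>LPA\<^esub> lpa_ghost_path G \<beta>)"
      unfolding y by (rule lpa_component_generator[OF p(1,2), symmetric])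
    also have "\<dots> \<oplus>\<^bsub>LPA\<^esub> lpa_class G (restrict_letters G z) \<in> lpa_component G n"
      using step.IH p unfolding lpa_component_def by (intro lin_span.add_smult) blast+
    finally show ?case .
  qed
  moreover have "restrict_letters G x = x"
    using x by (simp add: homogeneous_part_def nonunital_def carrier_free_algebra)
  ultimately show "X \<in> lpa_component G n" by (simp add: X)
qed

section \<open>The annihilator and its components\<close>

lemma perp_class_iff:
  fixes I :: "('a, 'b, 'k :: field) lpa set"
  assumes I: "two_sided_ideal LPA I" and a: "a \<in> nonunital"
  shows "lpa_class G a \<in> perp LPA I \<longleftrightarrow>
    (\<forall>b\<in>nonunital. lpa_class G b \<in> I \<longrightarrow> a * b \<in> leavitt_ideal G \<and> b * a \<in> leavitt_ideal G)"
proof -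
  have sub: "I \<subseteq> lpa_class G ` nonunital"
    using additive_subgroup.a_subset I unfolding two_sided_ideal_def lpa_carrier[symmetric] by blast
  have "lpa_class G a \<in> perp LPA I \<longleftrightarrow> (\<forall>x\<in>I. lpa_class G a \<otimes>\<^bsub>LPA\<^esub> x = \<zero>\<^bsub>LPA\<^esub> \<and> x \<otimes>\<^bsub>LPA\<^esub> lpa_class G a = \<zero>\<^bsub>LPA\<^esub>)"
    using a by (simp add: perp_def lpa_carrier)
  also have "\<dots> \<longleftrightarrow> (\<forall>b\<in>nonunital. lpa_class G b \<in> I \<longrightarrow>
      lpa_class G a \<otimes>\<^bsub>LPA\<^esub> lpa_class G b = \<zero>\<^bsub>LPA\<^esub> \<and> lpa_class G b \<otimes>\<^bsub>LPA\<^esub> lpa_class G a = \<zero>\<^bsub>LPA\<^esub>)"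
    using sub by blast
  also have "\<dots> \<longleftrightarrow> (\<forall>b\<in>nonunital. lpa_class G b \<in> I \<longrightarrow> a * b \<in> leavitt_ideal G \<and> b * a \<in> leavitt_ideal G)"
    using a by (intro ball_cong refl imp_cong) (simp add: lpa_mult nonunital_carrier lpa_class_eq_zero_iff)
  finally show ?thesis .
qed

lemma perp_component:
  fixes I :: "('a, 'b, 'k :: field) lpa set"
  assumes I: "two_sided_ideal LPA I" and a: "a \<in> nonunital" and perp: "lpa_class G a \<in> perp LPA I"
  shows "lpa_class G (component n a) \<in> perp LPA I"
  unfolding perp_class_iff[OF I nonunital_component[OF a]]
proof (intro ballI impI)
  interpret graded_ring_ideal "extended_ideal :: ('a, 'b, 'k) free_alg set" component "{x. Poly_Mapping.lookup x 0 = 0}"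
    by (rule graded_extended_ideal)
  fix b :: "('a, 'b, 'k) free_alg" assume b: "b \<in> nonunital" "lpa_class G b \<in> I"
  have ab: "a * b' \<in> leavitt_ideal G" if "b' \<in> nonunital" "lpa_class G b' \<in> I" for b'
    using perp that unfolding perp_class_iff[OF I a] by blast
  have "a * r * b \<in> extended_ideal" for r
  proof -
    define c where "c = Poly_Mapping.lookup r 0"
    \<comment> \<open>r runs through the whole unital free algebra, whereas I only absorbs elements
      of L. Hence the restricted r is split into s without constant term, for which s b represents
      an element of I, and the constant c, for which a b = 0 suffices.\<close>
    define s where "s = restrict_letters G r - scalar c"
    have s: "s \<in> nonunital"
      unfolding s_def c_def nonunital_def
      by (simp add: carrier_closed restrict_letters_carrier lookup_minus lookup_filter_keys letters_zero)
    have "lpa_class G s \<otimes>\<^bsub>LPA\<^esub> lpa_class G b \<in> I"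
      using I b(2) s unfolding two_sided_ideal_def lpa_carrier by blast
    then have "lpa_class G (s * b) \<in> I" using s b by (simp add: lpa_mult nonunital_carrier)
    then have "a * (s * b) \<in> leavitt_ideal G" using ab nonunital_mult[OF s b(1)] by blast
    moreover have "scalar c * (a * b) \<in> leavitt_ideal G"
      by (rule leavitt_ideal_lmult[OF ab[OF b] carrier_closed(5)])
    ultimately have "a * (s * b) + scalar c * (a * b) \<in> leavitt_ideal G" by (rule leavitt_ideal_add)
    also have "a * (s * b) + scalar c * (a * b) = a * restrict_letters G r * b"
      by (simp add: s_def algebra_simps scalar_left_commute[of a c b])
    also have "\<dots> = restrict_letters G (a * r * b)"
      using a b by (simp add: restrict_letters_mult nonunital_def carrier_free_algebra)
    finally show ?thesis by (simp add: extended_ideal_def)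
  qed
  then have "component n a * b \<in> extended_ideal" "b * component n a \<in> extended_ideal"
    using component_annihilates[of a b] a b by (simp_all add: nonunital_def)
  moreover have "component n a * b \<in> carrier (free_algebra G)" "b * component n a \<in> carrier (free_algebra G)"
    using a b by (intro carrier_closed nonunital_carrier nonunital_component; simp)+
  ultimately show "component n a * b \<in> leavitt_ideal G \<and> b * component n a \<in> leavitt_ideal G"
    using extended_ideal_iff by blast
qed

text \<open>A zero entry receives the representative 0 instead of an arbitrary element of the
  Leavitt ideal. Hence the representatives vanish outside the support and can be summed over any
  finite superset of it.\<close>

lemma homogeneous_representatives:
  fixes x :: "int \<Rightarrow> ('a, 'b, 'k :: field) lpa"
  assumes "\<And>i. x i \<in> lpa_component G i"
  obtains h where "\<And>i. h i \<in> homogeneous_part i" "\<And>i. x i = lpa_class G (h i)"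
    "\<And>i. x i = \<zero>\<^bsub>LPA\<^esub> \<Longrightarrow> h i = 0"
proof -
  have "\<forall>i. \<exists>h. h \<in> homogeneous_part i \<and> x i = lpa_class G h \<and> (x i = \<zero>\<^bsub>LPA\<^esub> \<longrightarrow> h = 0)"
  proof
    fix i
    show "\<exists>h. h \<in> homogeneous_part i \<and> x i = lpa_class G h \<and> (x i = \<zero>\<^bsub>LPA\<^esub> \<longrightarrow> h = 0)"
    proof (cases "x i = \<zero>\<^bsub>LPA\<^esub>")
      case True
      then show ?thesis
        by (intro exI[of _ 0]) (simp add: homogeneous_part_def nonunital_zero lpa_zero)
    next
      case False
      then show ?thesis using assms[of i] by (auto simp: lpa_component_eq)
    qed
  qed
  then show thesis using that by metis
qed

lemma component_sum_homogeneous: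
  assumes "finite T" "\<And>i. h i \<in> homogeneous_part i"
  shows "component n (sum h T) = (if n \<in> T then h n else 0)"
proof -
  have "component n (sum h T) = (\<Sum>i\<in>T. if n = i then h i else 0)"
    using assms(2) unfolding filter_keys_sum
    by (intro sum.cong) (auto simp: homogeneous_part_def component_homogeneous)
  then show ?thesis using assms(1) by simp
qed

theorem perp_is_internal_direct_sum:
  fixes I :: "('a, 'b, 'k :: field) lpa set"
  assumes I: "two_sided_ideal LPA I"
  shows "is_internal_direct_sum LPA (perp LPA I) (\<lambda>n. perp LPA I \<inter> lpa_component G n)"
  unfolding is_internal_direct_sum_def
proof (rule bij_betw_imageI)
  let ?supp = "\<lambda>x :: int \<Rightarrow> ('a, 'b, 'k) lpa. {i. x i \<noteq> \<zero>\<^bsub>LPA\<^esub>}"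
  let ?D = "{x. (\<forall>i. x i \<in> perp LPA I \<inter> lpa_component G i) \<and> finite (?supp x)}"
  have finsum: "finsum LPA x (?supp x) = lpa_class G (sum h T)"
    if "finite T" "?supp x \<subseteq> T" and h: "\<And>i. h i \<in> homogeneous_part i" "\<And>i. x i = lpa_class G (h i)"
      "\<And>i. x i = \<zero>\<^bsub>LPA\<^esub> \<Longrightarrow> h i = 0" for x h T
  proof -
    have "finsum LPA x (?supp x) = lpa_class G (sum h (?supp x))"
      using that by (intro lpa_finsum) (auto simp: homogeneous_part_def intro: finite_subset)
    also have "sum h (?supp x) = sum h T"
      using that by (intro sum.mono_neutral_left) auto
    finally show ?thesis .
  qed
  show "inj_on (\<lambda>x. finsum LPA x (?supp x)) ?D"
  proof (rule inj_onI)
    fix x y assume x: "x \<in> ?D" and y: "y \<in> ?D"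
      and eq: "finsum LPA x (?supp x) = finsum LPA y (?supp y)"
    \<comment> \<open>The two families may have different supports; summing over the union makes
      their components comparable.\<close>
    define T where "T = ?supp x \<union> ?supp y"
    have T: "finite T" using x y by (simp add: T_def)
    obtain h where h: "\<And>i. h i \<in> homogeneous_part i" "\<And>i. x i = lpa_class G (h i)"
      "\<And>i. x i = \<zero>\<^bsub>LPA\<^esub> \<Longrightarrow> h i = 0"
      using homogeneous_representatives[of x] x by blast
    obtain k where k: "\<And>i. k i \<in> homogeneous_part i" "\<And>i. y i = lpa_class G (k i)"
      "\<And>i. y i = \<zero>\<^bsub>LPA\<^esub> \<Longrightarrow> k i = 0"
      using homogeneous_representatives[of y] y by blast
    have "lpa_class G (sum h T) = lpa_class G (sum k T)"
      using eq finsum[OF T _ h] finsum[OF T _ k] by (simp add: T_def)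
    then have "sum h T - sum k T \<in> leavitt_ideal G" by (simp add: lpa_class_eq_iff)
    then have *: "component n (sum h T) - component n (sum k T) \<in> leavitt_ideal G" for n
      using component_leavitt_ideal[of "sum h T - sum k T" n] by (simp add: filter_keys_diff)
    show "x = y"
    proof
      fix n
      show "x n = y n"
      proof (cases "n \<in> T")
        case True
        then have "h n - k n \<in> leavitt_ideal G"
          using *[of n] by (simp add: component_sum_homogeneous[OF T h(1)] component_sum_homogeneous[OF T k(1)])
        then show ?thesis by (simp add: h(2) k(2) lpa_class_eq_iff)
      next
        case False
        then show ?thesis by (simp add: T_def)
      qed
    qed
  qed
  show "(\<lambda>x. finsum LPA x (?supp x)) ` ?D = perp LPA I"
  proof (intro equalityI subsetI)
    fix p assume "p \<in> (\<lambda>x. finsum LPA x (?supp x)) ` ?D"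
    then obtain x where x: "x \<in> ?D" and p: "p = finsum LPA x (?supp x)" by blast
    obtain h where h: "\<And>i. h i \<in> homogeneous_part i" "\<And>i. x i = lpa_class G (h i)"
      "\<And>i. x i = \<zero>\<^bsub>LPA\<^esub> \<Longrightarrow> h i = 0"
      using homogeneous_representatives[of x] x by blast
    have hn: "h i \<in> nonunital" for i using h(1) by (simp add: homogeneous_part_def)
    have "lpa_class G (h i) \<in> perp LPA I" for i using x h(2)[symmetric] by simp
    then have "lpa_class G (sum h (?supp x)) \<in> perp LPA I"
      unfolding perp_class_iff[OF I hn] perp_class_iff[OF I nonunital_sum[OF hn]]
      by (auto simp: sum_distrib_left sum_distrib_right intro!: leavitt_ideal_sum)
    then show "p \<in> perp LPA I" using finsum[OF _ order_refl h] x by (simp add: p)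
  next
    fix p assume p: "p \<in> perp LPA I"
    then obtain a where a: "p = lpa_class G a" "a \<in> nonunital" by (auto simp: perp_def lpa_carrier)
    define x where "x n = lpa_class G (component n a)" for n
    \<comment> \<open>The inclusion may be strict, because a nonzero component of a can lie in the
      Leavitt ideal. Such components make up the difference between a and the sum over the support
      of x.\<close>
    have supp: "?supp x \<subseteq> {n. component n a \<noteq> 0}" by (auto simp: x_def lpa_zero)
    have fin: "finite (?supp x)" by (rule finite_subset[OF supp finite_component])
    have "x i \<in> perp LPA I" for i
      unfolding x_def using perp_component[OF I a(2)] p a(1) by blast
    moreover have "x i \<in> lpa_component G i" for i
      unfolding x_def lpa_component_eq
      by (intro imageI) (simp add: homogeneous_part_def nonunital_component a homogeneous_def component_component)
    ultimately have "x \<in> ?D" using fin by blast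
    moreover have "finsum LPA x (?supp x) = p"
    proof -
      have "finsum LPA x (?supp x) = lpa_class G (\<Sum>n\<in>?supp x. component n a)"
        by (intro lpa_finsum fin) (simp_all add: x_def nonunital_component a)
      also have "\<dots> = lpa_class G a"
      proof -
        have "a = (\<Sum>n | component n a \<noteq> 0. component n a)"
          by (rule sum_component[symmetric]) (auto simp: finite_component)
        also have "\<dots> = (\<Sum>n\<in>?supp x. component n a) + (\<Sum>n\<in>{n. component n a \<noteq> 0} - ?supp x. component n a)"
          by (subst add.commute, rule sum.subset_diff[OF supp finite_component])
        finally have "a - (\<Sum>n\<in>?supp x. component n a) = (\<Sum>n\<in>{n. component n a \<noteq> 0} - ?supp x. component n a)"
          by (simp add: algebra_simps)
        also have "\<dots> \<in> leavitt_ideal G"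
          by (intro leavitt_ideal_sum) (simp add: x_def lpa_class_eq_zero_iff)
        finally show ?thesis using lpa_class_eq_iff by metis
      qed
      finally show ?thesis by (simp add: a)
    qed
    ultimately show "p \<in> (\<lambda>x. finsum LPA x (?supp x)) ` ?D" by blast
  qed
qed

end

theorem theorem3p3:
  fixes E :: "('v, 'e) pre_digraph"
    and I :: "('v, 'e, 'k :: field) lpa set"
  assumes "countable_digraph E"
    and "two_sided_ideal (leavitt_path_algebra E) I"
  shows "is_internal_direct_sum (leavitt_path_algebra E)
    (perp (leavitt_path_algebra E) I)
    (\<lambda>n :: int. perp (leavitt_path_algebra E) I \<inter> lpa_component E n)"
  using countable_digraph.perp_is_internal_direct_sum[OF assms] .

end
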